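(* Let $m\ge 2$, $n=2^m-1$, let $h_2(X)\in\mathbb{Z}_2[X]$ be a primitive irreducible polynomial of degree $m$, and let $h(X)\in\mathbb{Z}_4[X]$ be the unique monic polynomial of degree $m$ such that $h(X)\equiv h_2(X)\pmod 2$ and $h(X)$ divides $X^n-1$ in $\mathbb{Z}_4[X]$. Let $g(X)$ be the reciprocal polynomial to $(X^n-1)/((X-1)h(X))$. Then the cyclic code over $\mathbb{Z}_4$ of length $n$ generated by $g(X)$, extended by an overall parity check, is a quaternary linear code $D$ of length $2^m$ containing $4^{m+1}$ words. Moreover, for $m$ odd, $m\ge 3$, the corresponding binary code $K=\phi(D)$ is (up to a permutation of coordinates) the Kerdock code of length $2^{m+1}$, which contains $2^{2m+2}$ words and has minimal distance $2^m-2^{(m-1)/2}$.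
   Context: Cyclic codes: the cyclic code of length $n$ over $\mathbb{Z}_4$ generated by $g(X)$ is the set of coefficient vectors $(c_0,\dots,c_{n-1})$ of elements of the ideal generated by $g(X)$ in $\mathbb{Z}_4[X]/(X^n-1)$. Extending by an overall parity check means appending to each codeword a coordinate $c_\infty=-\sum_i c_i$. The reciprocal polynomial to a polynomial $f$ of degree $d$ is $X^d f(1/X)$. "Primitive" means that a root of $h_2$ generates the multiplicative group of $\mathbb{F}_{2^m}$. Binary image: define $\beta,\gamma:\mathbb{Z}_4\to\mathbb{Z}_2$ by $\beta(0),\beta(1),\beta(2),\beta(3)=0,0,1,1$ and $\gamma(0),\gamma(1),\gamma(2),\gamma(3)=0,1,1,0$, extended componentwise to $\mathbb{Z}_4^N$, and $\phi:\mathbb{Z}_4^N\to\mathbb{Z}_2^{2N}$, $\phi(a)=(\beta(a),\gamma(a))$. The minimal distance of a (possibly nonlinear) code is the minimum Hamming distance between distinct codewords. Kerdock code (standard definition): let $m\ge 3$ be odd, $F=\mathbb{F}_{2^m}$, $\mathrm{tr}:F\to\mathbb{F}_2$ the absolute trace, and $Q(x)=\sum_{j=1}^{(m-1)/2}\mathrm{tr}(x^{1+2^j})$ for $x\in F$. Identify binary vectors of length $2^{m+1}$ with pairs $(f_1,f_2)$ of functions $F\to\mathbb{F}_2$ (the left and right halves). The Kerdock code of length $2^{m+1}$ is the union, over all $\pi\in F$, of the cosets $w_\pi+RM(1,m+1)$, where $w_\pi=\bigl(Q(\pi x),\;Q(\pi x)+\mathrm{tr}(\pi x)\bigr)$ and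 $RM(1,m+1)=\{(\mathrm{tr}(\eta x)+B,\ \mathrm{tr}(\eta x)+B'):\eta\in F,\ B,B'\in\mathbb{F}_2\}$ is the first-order Reed-Muller code. *)

theory Defs
  imports
    "HOL-Library.Numeral_Type"
    "HOL-Library.Z2"
    "HOL-Computational_Algebra.Polynomial_Factorial"
    "HOL-Combinatorics.Permutations"
    "HOL-Algebra.Algebraic_Closure_Type"
begin

hide_const (open) Divisibility.irreducible Divisibility.prime
hide_const (open) UnivPoly.monom Polynomials.degree Polynomials.lead_coeff

text \<open>
  \<open>\<int>\<^sub>4\<close> is the numeral type \<open>4\<close>, \<open>\<int>\<^sub>2\<close> is the field \<open>bit\<close>, and vectors over either are lists.
\<close>

type_synonym z4 = 4

definition red2 :: "z4 \<Rightarrow> bit" where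
  "red2 x = (if x = 1 \<or> x = 3 then 1 else 0)"

text \<open>
  The field with \<open>2\<^sup>m\<close> elements is realised inside the algebraic closure of \<open>\<int>\<^sub>2\<close>, as the set of
  roots of \<open>X\<^bsup>2^m\<^esup> - X\<close>; thus it is available for every \<open>m > 0\<close> without a further hypothesis.
\<close>

definition GF2 :: "nat \<Rightarrow> bit alg_closure set" where
  "GF2 m = {x. x ^ (2 ^ m) = x}"

definition primitive_poly :: "nat \<Rightarrow> bit poly \<Rightarrow> bool" where
  "primitive_poly m f \<longleftrightarrow>
     (\<exists>\<alpha>. poly (map_poly to_ac f) \<alpha> = 0 \<and> range (\<lambda>k::nat. \<alpha> ^ k) = GF2 m - {0})"

text \<open>
  The operation \<open>div\<close> on polynomials needs an integral domain, which \<open>\<int>\<^sub>4\<close> is not. The quotient below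
  is unique whenever \<open>q\<close> is monic and divides \<open>p\<close>.
\<close>

definition exact_quotient :: "'a::comm_ring_1 poly \<Rightarrow> 'a poly \<Rightarrow> 'a poly" where
  "exact_quotient p q = (THE r. p = q * r)"

text \<open>
  Each class of polynomials modulo \<open>X\<^sup>n - 1\<close> has exactly one representative of the form \<open>Poly c\<close>
  with \<open>c\<close> of length \<open>n\<close>, and \<open>c\<close> is its coefficient vector.
\<close>

definition cyclic_code :: "nat \<Rightarrow> 'a::comm_ring_1 poly \<Rightarrow> 'a list set" where
  "cyclic_code n g = {c. length c = n \<and> (\<exists>a. (monom 1 n - 1) dvd (Poly c - a * g))}"

definition parity_extend :: "'a::ab_group_add list \<Rightarrow> 'a list" where
  "parity_extend c = c @ [- sum_list c]"

definition linear_code :: "nat \<Rightarrow> 'a::comm_ring_1 list set \<Rightarrow> bool" where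
  "linear_code N C \<longleftrightarrow>
     C \<subseteq> {c. length c = N} \<and> replicate N 0 \<in> C \<and>
     (\<forall>u\<in>C. \<forall>v\<in>C. map2 (+) u v \<in> C) \<and> (\<forall>a. \<forall>u\<in>C. map ((*) a) u \<in> C)"

definition \<beta> :: "z4 \<Rightarrow> bit" where
  "\<beta> x = (if x = 2 \<or> x = 3 then 1 else 0)"

definition \<gamma> :: "z4 \<Rightarrow> bit" where
  "\<gamma> x = (if x = 1 \<or> x = 2 then 1 else 0)"

definition \<phi> :: "z4 list \<Rightarrow> bit list" where
  "\<phi> a = map \<beta> a @ map \<gamma> a"

definition hamming_distance :: "'a list \<Rightarrow> 'a list \<Rightarrow> nat" where
  "hamming_distance u v = card {i. i < length u \<and> u ! i \<noteq> v ! i}"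

definition minimal_distance :: "'a list set \<Rightarrow> nat" where
  "minimal_distance C = Min {hamming_distance u v | u v. u \<in> C \<and> v \<in> C \<and> u \<noteq> v}"

definition equal_up_to_permutation :: "nat \<Rightarrow> 'a list set \<Rightarrow> 'a list set \<Rightarrow> bool" where
  "equal_up_to_permutation N C C' \<longleftrightarrow> (\<exists>\<pi>. \<pi> permutes {..<N} \<and> permute_list \<pi> ` C = C')"

text \<open>
  For \<open>x \<in> GF2 m\<close> the sum of the conjugates of \<open>x\<close> lies in the prime field.
\<close>

definition trace :: "nat \<Rightarrow> bit alg_closure \<Rightarrow> bit" where
  "trace m x = (THE b. to_ac b = (\<Sum>i<m. x ^ (2 ^ i)))"

definition Q :: "nat \<Rightarrow> bit alg_closure \<Rightarrow> bit" where
  "Q m x = (\<Sum>j = 1..(m - 1) div 2. trace m (x ^ (1 + 2 ^ j)))"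

text \<open>
  In the following the list \<open>xs\<close> enumerates \<open>GF2 m\<close> without repetitions. The pair of functions
  \<open>(f\<^sub>1, f\<^sub>2)\<close> on \<open>GF2 m\<close> is identified with the vector of length \<open>2\<^bsup>m+1\<^esup>\<close> whose left and right
  halves list the values of \<open>f\<^sub>1\<close> and \<open>f\<^sub>2\<close> in the order given by \<open>xs\<close>.
\<close>

definition pair_vec ::
  "bit alg_closure list \<Rightarrow> (bit alg_closure \<Rightarrow> bit) \<Rightarrow> (bit alg_closure \<Rightarrow> bit) \<Rightarrow> bit list" where
  "pair_vec xs f\<^sub>1 f\<^sub>2 = map f\<^sub>1 xs @ map f\<^sub>2 xs"

definition RM1 :: "nat \<Rightarrow> bit alg_closure list \<Rightarrow> bit list set" where
  "RM1 m xs =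
     {pair_vec xs (\<lambda>x. trace m (\<eta> * x) + B) (\<lambda>x. trace m (\<eta> * x) + B') | \<eta> B B'. \<eta> \<in> GF2 m}"

definition kerdock_code :: "nat \<Rightarrow> bit alg_closure list \<Rightarrow> bit list set" where
  "kerdock_code m xs =
     (\<Union>\<pi> \<in> GF2 m.
        (\<lambda>r. map2 (+) (pair_vec xs (\<lambda>x. Q m (\<pi> * x)) (\<lambda>x. Q m (\<pi> * x) + trace m (\<pi> * x))) r)
          ` RM1 m xs)"

end

theory Submission
  imports Defs Complex_Main
begin

text \<open>
  Everything is computed inside the finite field \<open>F\<close> with \<open>2\<^sup>m\<close> elements. For odd \<open>m\<close> the function
  \<open>q(x) = tr(x) + 2 Q(x)\<close> from \<open>F\<close> to the integers modulo 4 satisfies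
  \<open>q(x + y) = q(x) + q(y) + 2 tr(x y)\<close>, hence the words \<open>q(a x) + 2 tr(b x) + e\<close> are closed under
  subtraction and under \<open>x \<mapsto> \<alpha> x\<close>. Reading them along the powers of a primitive element
  \<open>\<alpha>\<close>, a root of the binary polynomial, gives \<open>4\<^bsup>m+1\<^esup>\<close> sequences annihilated by
  \<open>(X - 1) h(X)\<close>; these make up the whole cyclic code, and the coordinate at \<open>0\<close> is the parity
  check. The Gray map sends these words to the Kerdock words and turns distances into values of the
  sums of \<open>\<i>\<^bsup>q(a x) + 2 tr(b x) + e\<^esup>\<close>. For \<open>a \<noteq> 0\<close> such a sum is a Gaussian integer of norm
  \<open>2\<^sup>m\<close>, so its real part is \<open>\<plusminus> 2\<^bsup>(m-1)/2\<^esup>\<close>.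
\<close>


section \<open>The rings of integers modulo 2 and 4\<close>

text \<open>The function q is a Galois ring trace in disguise. Working with q keeps the computations
  in a field of characteristic 2, at a price: annihilation by \<open>h\<close> must be proved
  without a root of \<open>h\<close> at hand, from reductions modulo 2 and the period
  \<open>n\<close> alone. Two obstacles shape the rest. Polynomials modulo 4 have zero divisors, so
  degree counts and cancellations go through leading coefficients that are units. And the addition
  law of q relies on odd \<open>m\<close>, so the size of \<open>D\<close> for general
  \<open>m\<close> is read off from the degree of the generator; the words enter only for odd
  \<open>m\<close>, where one inclusion and a comparison of sizes suffice. That distinct parameters
  give distinct words is itself a consequence of the distance bound.\<close>

declare add_bit_eq_xor [simp del] mult_bit_eq_and [simp del]

lemma z4_cases: "(x::z4) = 0 \<or> x = 1 \<or> x = 2 \<or> x = 3"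
proof -
  have "{0, 1, 2, 3 :: z4} = UNIV"
    by (rule card_subset_eq) simp_all
  then show ?thesis by blast
qed

text \<open>A section of \<open>red2\<close> that is not additive. With \<open>twice_bit\<close>,
  which identifies bits with the ideal of even elements, it gives the binary expansion
  \<open>lift_bit a + twice_bit b\<close> of an element modulo 4.\<close>

definition lift_bit :: "bit \<Rightarrow> z4" where
  "lift_bit b = (if b = 1 then 1 else 0)"

definition twice_bit :: "bit \<Rightarrow> z4" where
  "twice_bit b = (if b = 1 then 2 else 0)"

lemma red2_0 [simp]: "red2 0 = 0"
  and red2_1 [simp]: "red2 1 = 1"
  and red2_twice_bit [simp]: "red2 (twice_bit b) = 0"
  and red2_lift_bit [simp]: "red2 (lift_bit b) = b"
  by (cases b; simp add: red2_def twice_bit_def lift_bit_def)+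

lemma red2_add [simp]: "red2 (x + y) = red2 x + red2 y"
  using z4_cases[of x] z4_cases[of y] by (auto simp: red2_def)

lemma red2_mult [simp]: "red2 (x * y) = red2 x * red2 y"
  using z4_cases[of x] z4_cases[of y] by (auto simp: red2_def)

lemma red2_diff [simp]: "red2 (x - y) = red2 x - red2 y"
  using z4_cases[of x] z4_cases[of y] by (auto simp: red2_def)

lemma red2_sum: "red2 (sum f A) = (\<Sum>x\<in>A. red2 (f x))"
  by (induction A rule: infinite_finite_induct) simp_all

lemma twice_bit_0 [simp]: "twice_bit 0 = 0"
  by (simp add: twice_bit_def)

lemma lift_bit_0 [simp]: "lift_bit 0 = 0"
  and lift_bit_1 [simp]: "lift_bit 1 = 1"
  by (simp_all add: lift_bit_def)

lemma lift_bit_eq_0_iff [simp]: "lift_bit b = 0 \<longleftrightarrow> b = 0"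
  by (cases b) (simp_all add: lift_bit_def)

lemma twice_bit_eq_0_iff [simp]: "twice_bit b = 0 \<longleftrightarrow> b = 0"
  by (cases b) (simp_all add: twice_bit_def)

lemma twice_bit_add: "twice_bit (a + b) = twice_bit a + twice_bit b"
  by (cases a; cases b) (simp_all add: twice_bit_def)

lemma twice_bit_uminus: "- twice_bit a = twice_bit a"
  by (cases a) (simp_all add: twice_bit_def)

lemma twice_bit_sum: "twice_bit (sum f A) = (\<Sum>x\<in>A. twice_bit (f x))"
  by (induction A rule: infinite_finite_induct) (simp_all add: twice_bit_add)

text \<open>The even elements form a module over the field of two elements. In particular a product
  of two even elements vanishes, which linearizes all later corrections modulo 4.\<close>

lemma mult_twice_bit: "x * twice_bit b = twice_bit (red2 x * b)"
  using z4_cases[of x] by (cases b) (auto simp: red2_def twice_bit_def)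

lemma red2_eq_0_imp: "red2 x = 0 \<Longrightarrow> \<exists>b. x = twice_bit b"
  using z4_cases[of x]
  by (auto simp: red2_def twice_bit_def intro: exI[of _ 0] exI[of _ 1] split: if_splits)

lemma red2_eq_1_imp_unit: "red2 x = 1 \<Longrightarrow> x * x = 1"
  using z4_cases[of x] by (auto simp: red2_def)

text \<open>The product \<open>a * b\<close> is the carry of binary addition.\<close>

lemma lift_bit_add: "lift_bit (a + b) = lift_bit a + lift_bit b + twice_bit (a * b)"
  by (cases a; cases b) (simp_all add: lift_bit_def twice_bit_def)

lemma z4_decomp: "\<exists>a b. x = lift_bit a + twice_bit b"
proof -
  have "0 = lift_bit 0 + twice_bit 0" "1 = lift_bit 1 + twice_bit 0"
    "2 = lift_bit 0 + twice_bit 1" "3 = lift_bit 1 + twice_bit 1"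
    by (simp_all add: lift_bit_def twice_bit_def)
  with z4_cases[of x] show ?thesis by blast
qed

text \<open>In binary digits the Gray map returns the high digit and the sum of both digits; hence
  the extra trace term in the right half of a Kerdock word.\<close>

lemma beta_lift_twice [simp]: "\<beta> (lift_bit a + twice_bit b) = b"
  by (cases a; cases b) (simp_all add: \<beta>_def lift_bit_def twice_bit_def)

lemma gamma_lift_twice [simp]: "\<gamma> (lift_bit a + twice_bit b) = a + b"
  by (cases a; cases b) (simp_all add: \<gamma>_def lift_bit_def twice_bit_def)

lemma bit_plus_self [simp]: "(b::bit) + b = 0"
  by (cases b) simp_all

section \<open>Polynomials over the integers modulo 4\<close>

abbreviation (input) "red_poly \<equiv> map_poly red2"
abbreviation (input) "twice_poly \<equiv> map_poly twice_bit"
abbreviation (input) "lift_poly \<equiv> map_poly lift_bit"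

lemma red_poly_add: "red_poly (p + q) = red_poly p + red_poly q"
  by (rule poly_eqI) (simp add: coeff_map_poly)

lemma red_poly_diff: "red_poly (p - q) = red_poly p - red_poly q"
  by (rule poly_eqI) (simp add: coeff_map_poly)

lemma red_poly_mult: "red_poly (p * q) = red_poly p * red_poly q"
  by (rule poly_eqI) (simp add: coeff_map_poly coeff_mult red2_sum)

lemma red_poly_monom: "red_poly (monom c k) = monom (red2 c) k"
  by (rule poly_eqI) (simp add: coeff_map_poly)

lemma red_poly_1 [simp]: "red_poly 1 = 1"
  by (rule poly_eqI) (simp add: coeff_map_poly)

lemma red_twice_poly [simp]: "red_poly (twice_poly q) = 0"
  by (rule poly_eqI) (simp add: coeff_map_poly)

lemma red_lift_poly [simp]: "red_poly (lift_poly q) = q"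
  by (rule poly_eqI) (simp add: coeff_map_poly)

lemma twice_poly_add: "twice_poly (p + q) = twice_poly p + twice_poly q"
  by (rule poly_eqI) (simp add: coeff_map_poly twice_bit_add)

lemma mult_twice_poly: "p * twice_poly q = twice_poly (red_poly p * q)"
  by (rule poly_eqI) (simp add: coeff_map_poly coeff_mult twice_bit_sum mult_twice_bit)

lemma twice_poly_eq_0_iff [simp]: "twice_poly p = 0 \<longleftrightarrow> p = 0"
  by (auto simp: poly_eq_iff coeff_map_poly)

lemma degree_twice_poly: "degree (twice_poly p) = degree p"
  by (rule degree_map_poly) simp

lemma red_poly_eq_0_imp:
  assumes "red_poly p = 0"
  shows "\<exists>q. p = twice_poly q"
proof -
  have "\<exists>b. coeff p i = twice_bit b" for i
    using assms by (intro red2_eq_0_imp) (metis coeff_map_poly coeff_0 red2_0)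
  then obtain f where f: "\<And>i. coeff p i = twice_bit (f i)" by metis
  define q where "q = Poly (map f [0..<Suc (degree p)])"
  have "p = twice_poly q"
  proof (rule poly_eqI)
    fix i
    show "coeff p i = coeff (twice_poly q) i"
      using f[of i] coeff_eq_0[of p i]
      by (cases "i \<le> degree p")
        (simp_all add: q_def coeff_map_poly nth_default_def del: upt_Suc)
  qed
  then show ?thesis ..
qed

lemma red_poly_eq_imp:
  assumes "red_poly p = red_poly q"
  shows "\<exists>r. p = q + twice_poly r"
proof -
  have "red_poly (p - q) = 0" using assms by (simp add: red_poly_diff)
  then obtain r where "p - q = twice_poly r" using red_poly_eq_0_imp by blast
  then have "p = q + twice_poly r" by (simp add: algebra_simps)
  then show ?thesis ..
qed

text \<open>A unit as leading coefficient replaces the absence of zero divisors. The inverse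
  \<open>u\<close> is kept general because reciprocal polynomials need not be monic.\<close>

lemma monic_mult_eq_0:
  fixes p q :: "'a::comm_ring_1 poly"
  assumes "lead_coeff p * u = 1" "p * q = 0"
  shows "q = 0"
proof -
  have "lead_coeff p * lead_coeff q = 0"
    using assms(2) by (metis coeff_0 coeff_mult_degree_sum)
  then have "lead_coeff p * u * lead_coeff q = 0" by (simp add: algebra_simps)
  then show ?thesis using assms(1) by simp
qed

lemma unit_lead_coeff_mult_cancel:
  fixes p q r :: "'a::comm_ring_1 poly"
  assumes "lead_coeff p * u = 1" "p * q = p * r"
  shows "q = r"
  using monic_mult_eq_0[OF assms(1), of "q - r"] assms(2) by (simp add: algebra_simps)

lemma unit_lead_coeff_degree_mult:
  fixes p q :: "'a::comm_ring_1 poly"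
  assumes "lead_coeff p * u = 1" "q \<noteq> 0"
  shows "degree (p * q) = degree p + degree q"
    and "lead_coeff (p * q) = lead_coeff p * lead_coeff q"
proof -
  have "lead_coeff p * lead_coeff q \<noteq> 0"
  proof
    assume "lead_coeff p * lead_coeff q = 0"
    then have "lead_coeff p * u * lead_coeff q = 0" by (simp add: algebra_simps)
    then show False using assms by simp
  qed
  then show "degree (p * q) = degree p + degree q"
    using le_degree[of "p * q" "degree p + degree q"] degree_mult_le[of p q]
    by (simp add: coeff_mult_degree_sum)
  then show "lead_coeff (p * q) = lead_coeff p * lead_coeff q"
    by (simp add: coeff_mult_degree_sum)
qed

lemma red_poly_monic:
  fixes p :: "z4 poly"
  assumes "lead_coeff p = 1"
  shows "degree (red_poly p) = degree p" "lead_coeff (red_poly p) = 1"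
proof -
  show "degree (red_poly p) = degree p"
  proof (rule antisym)
    show "degree p \<le> degree (red_poly p)"
      using assms by (intro le_degree) (simp add: coeff_map_poly)
  qed (rule map_poly_degree_leq)
  then show "lead_coeff (red_poly p) = 1" using assms by (simp add: coeff_map_poly)
qed

lemma exact_quotient_eq:
  fixes q r :: "'a::comm_ring_1 poly"
  assumes "lead_coeff q = 1" "p = q * r"
  shows "exact_quotient p q = r"
  unfolding exact_quotient_def
  using assms unit_lead_coeff_mult_cancel[of q 1] by (intro the_equality) auto

section \<open>Hensel lifting\<close>

text \<open>An element of least degree in the ideal generated by \<open>p\<close> and
  \<open>a\<close> divides both, by division with remainder. Dividing the irreducible
  \<open>p\<close> without being a multiple of it, it is a unit.\<close>

lemma bezout_irreducible:
  fixes p a :: "'a::field poly"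
  assumes "irreducible p" "\<not> p dvd a"
  shows "\<exists>u v. u * p + v * a = 1"
proof -
  define I where "I = {d. d \<noteq> 0 \<and> (\<exists>u v. d = u * p + v * a)}"
  have "p \<in> I" using assms(1) by (auto simp: I_def intro: exI[of _ 1] exI[of _ 0])
  then obtain d where d: "d \<in> I" "\<And>e. e \<in> I \<Longrightarrow> degree d \<le> degree e"
    using ex_has_least_nat[of "\<lambda>d. d \<in> I" p degree] by blast
  have dvd: "d dvd x" if "x = u * p + v * a" for x u v
  proof (rule ccontr)
    assume "\<not> d dvd x"
    then have ne: "x mod d \<noteq> 0" by (simp add: mod_eq_0_iff_dvd)
    obtain u' v' where uv: "d = u' * p + v' * a" using d(1) by (auto simp: I_def)
    have "x mod d = x - x div d * d" by (rule minus_div_mult_eq_mod[symmetric])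
    also have "\<dots> = (u - x div d * u') * p + (v - x div d * v') * a"
      using that arg_cong[OF uv, of "(*) (x div d)"] by (simp add: algebra_simps)
    finally have "x mod d \<in> I" using ne unfolding I_def by blast
    then have "degree d \<le> degree (x mod d)" by (rule d(2))
    moreover have "degree (x mod d) < degree d"
      using ne d(1) degree_mod_less[of d x] by (auto simp: I_def)
    ultimately show False by simp
  qed
  have "d dvd p" using dvd[of p 1 0] by simp
  have "d dvd a" using dvd[of a 0 1] by simp
  have "\<not> p dvd d" using \<open>d dvd a\<close> assms(2) dvd_trans by blast
  then have "is_unit d" using assms(1) \<open>d dvd p\<close> irreducibleD' by blast
  then obtain e where "1 = d * e" ..
  moreover obtain u v where "d = u * p + v * a" using d(1) by (auto simp: I_def)
  ultimately have "e * u * p + e * v * a = 1" by (simp add: algebra_simps)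
  then show ?thesis by blast
qed

text \<open>Coprimality modulo 2 solves \<open>h2 * B + k2 * A = E\<close>, where
  \<open>twice_poly E\<close> is the error of the naive product of lifts. One correction is exact,
  since products of even terms vanish.\<close>

lemma hensel_lift:
  fixes F :: "z4 poly" and h2 k2 :: "bit poly"
  assumes irr: "irreducible h2" and deg: "degree h2 = m"
    and F: "red_poly F = h2 * k2" and ndvd: "\<not> h2 dvd k2"
  shows "\<exists>f. lead_coeff f = 1 \<and> degree f = m \<and> red_poly f = h2 \<and> f dvd F"
proof -
  have h2: "h2 \<noteq> 0" using irr by auto
  have lead: "lead_coeff h2 = 1" using h2 by (cases "lead_coeff h2") simp_all
  have m: "m > 0"
    using irr deg h2 by (metis is_unit_iff_degree irreducible_not_unit gr0I)
  define H K where "H = lift_poly h2" and "K = lift_poly k2"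
  have "red_poly (F) = red_poly (H * K)"
    by (simp add: F red_poly_mult H_def K_def)
  then obtain E where E: "F = H * K + twice_poly E"
    using red_poly_eq_imp by blast
  obtain u v where uv: "u * h2 + v * k2 = 1"
    using bezout_irreducible[OF irr ndvd] by blast
  \<comment> \<open>A multiple of \<open>h2\<close> may be moved from \<open>A\<close> to
    \<open>B\<close>; taking the remainder keeps the degree of \<open>A\<close> below
    \<open>m\<close>, so the correction leaves \<open>f\<close> monic of degree
    \<open>m\<close>.\<close>
  define A where "A = (E * v) mod h2"
  define B where "B = E * u + (E * v) div h2 * k2"
  define q where "q = (E * v) div h2"
  have A: "A = E * v - q * h2"
    by (simp only: A_def q_def minus_div_mult_eq_mod)
  have "h2 * B + k2 * A = E * (u * h2 + v * k2)"
    unfolding A B_def q_def[symmetric] by (simp add: algebra_simps)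
  then have AB: "h2 * B + k2 * A = E" by (simp add: uv)
  define f where "f = H + twice_poly A"
  have dH: "degree H = m" by (simp add: H_def degree_map_poly deg)
  have dA: "degree A < m"
    using degree_mod_less[OF h2, of "E * v"] m by (auto simp: A_def deg)
  have df: "degree f = m"
    unfolding f_def using dH dA by (simp add: degree_add_eq_left degree_twice_poly)
  have lf: "lead_coeff f = 1"
    unfolding df using dA lead deg
    by (simp add: f_def H_def coeff_map_poly coeff_eq_0)
  have rf: "red_poly f = h2"
    by (simp add: f_def red_poly_add H_def)
  have "F = f * (K + twice_poly B)"
  proof -
    have "f * (K + twice_poly B) = H * K + H * twice_poly B + K * twice_poly A
            + twice_poly A * twice_poly B"
      by (simp add: f_def algebra_simps)
    also have "\<dots> = H * K + twice_poly (h2 * B + k2 * A)"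
      unfolding mult_twice_poly by (simp add: H_def K_def twice_poly_add)
    finally show ?thesis by (simp add: AB E)
  qed
  then have "f dvd F" ..
  with df lf rf show ?thesis by (intro exI[of _ f]) simp
qed

text \<open>Two lifts differ by an even polynomial \<open>twice_poly A\<close>. Comparing the
  factorizations gives \<open>h2 dvd red_poly k * A\<close>, hence \<open>h2 dvd A\<close>, while
  the degree of \<open>A\<close> is too small because both lifts are monic.\<close>

lemma hensel_unique:
  fixes f f' k k' :: "z4 poly"
  assumes "prime_elem h2" "\<not> h2 dvd red_poly k"
    and f: "lead_coeff f = 1" "degree f = m" "red_poly f = h2"
    and f': "lead_coeff f' = 1" "degree f' = m" "red_poly f' = h2"
    and eq: "f * k = f' * k'"
  shows "f = f'"
proof -
  have "h2 * red_poly k = h2 * red_poly k'"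
    using arg_cong[OF eq, of red_poly] f f' by (simp add: red_poly_mult)
  then have "red_poly k' = red_poly k" using assms(1) by auto
  then obtain B where B: "k' = k + twice_poly B" using red_poly_eq_imp by blast
  have "red_poly f' = red_poly f" using f f' by simp
  then obtain A where A: "f' = f + twice_poly A" using red_poly_eq_imp by blast
  have "0 = f * twice_poly B + k * twice_poly A + twice_poly A * twice_poly B"
    using eq unfolding A B by (simp add: algebra_simps)
  also have "\<dots> = twice_poly (h2 * B + red_poly k * A)"
    unfolding mult_twice_poly by (simp add: f twice_poly_add)
  finally have "h2 * B + red_poly k * A = 0" by (metis twice_poly_eq_0_iff)
  then have "red_poly k * A = h2 * (- B)" by (simp add: eq_neg_iff_add_eq_0 add.commute)
  then have dvd: "h2 dvd A" using assms(1,2) by (metis dvd_triv_left prime_elem_dvd_mult_iff)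
  have "A = 0"
  proof (rule ccontr)
    assume ne: "A \<noteq> 0"
    have "f' - f = twice_poly A" using A by simp
    have "coeff (twice_poly A) m = 0" using f f' \<open>f' - f = twice_poly A\<close>
      by (metis coeff_diff diff_self)
    moreover have "degree (twice_poly A) \<le> m"
      using f f' \<open>f' - f = twice_poly A\<close> by (metis degree_diff_le order_refl)
    ultimately have "degree A < m"
      using ne by (metis degree_twice_poly le_neq_implies_less leading_coeff_0_iff twice_poly_eq_0_iff)
    moreover have "degree h2 = m" using red_poly_monic(1)[OF f(1)] f by simp
    ultimately show False using dvd_imp_degree_le[OF dvd ne] by simp
  qed
  then show ?thesis by (simp add: A)
qed


section \<open>Finite fields of characteristic 2\<close>

lemma CHAR_bit [simp]: "CHAR(bit) = 2"
proof (rule CHAR_eqI)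
  fix x :: nat
  assume "of_nat x = (0 :: bit)"
  then have "even (of_nat x :: bit)" by simp
  then show "2 dvd x" by (simp only: even_of_nat)
qed simp

lemma ac_add_self [simp]: "(x :: bit alg_closure) + x = 0"
proof -
  have "- x = x" by (rule uminus_CHAR_2) simp
  then show ?thesis by (metis add.right_inverse)
qed

lemma ac_diff_eq_add: "(x :: bit alg_closure) - y = x + y"
  by (rule minus_CHAR_2) simp

lemma frobenius_add: "(x + y :: bit alg_closure) ^ (2 ^ k) = x ^ (2 ^ k) + y ^ (2 ^ k)"
  by (rule freshmans_dream') simp_all

lemma frobenius_sum: "sum f A ^ (2 ^ k) = (\<Sum>i\<in>A. f i ^ (2 ^ k) :: bit alg_closure)"
  by (rule freshmans_dream_sum') simp_all

lemma GF2_iff: "x \<in> GF2 m \<longleftrightarrow> x ^ (2 ^ m) = x"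
  by (simp add: GF2_def)

lemma GF2_0 [simp]: "0 \<in> GF2 m"
  and GF2_1 [simp]: "1 \<in> GF2 m"
  by (simp_all add: GF2_def)

lemma GF2_add [simp]: "x \<in> GF2 m \<Longrightarrow> y \<in> GF2 m \<Longrightarrow> x + y \<in> GF2 m"
  by (simp add: GF2_iff frobenius_add)

lemma GF2_mult [simp]: "x \<in> GF2 m \<Longrightarrow> y \<in> GF2 m \<Longrightarrow> x * y \<in> GF2 m"
  by (simp add: GF2_iff power_mult_distrib)

lemma GF2_power [simp]: "x \<in> GF2 m \<Longrightarrow> x ^ k \<in> GF2 m"
  unfolding GF2_iff by (metis power_mult mult.commute)

lemma GF2_sum: "(\<And>i. i \<in> A \<Longrightarrow> f i \<in> GF2 m) \<Longrightarrow> sum f A \<in> GF2 m"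
  by (induction A rule: infinite_finite_induct) simp_all

lemma GF2_inverse [simp]: "x \<in> GF2 m \<Longrightarrow> inverse x \<in> GF2 m"
  by (simp add: GF2_iff power_inverse)

lemma GF2_to_ac [simp]: "to_ac b \<in> GF2 m"
  by (cases b) simp_all

section \<open>Counting the elements of \<open>GF2 m\<close>\<close>

lemma card_roots_separable:
  fixes p :: "'a::alg_closed_field poly"
  assumes p: "p \<noteq> 0" and sep: "\<And>x. poly p x = 0 \<Longrightarrow> poly (pderiv p) x \<noteq> 0"
  shows "card {x. poly p x = 0} = degree p"
proof -
  obtain A where A: "size A = degree p" "p = smult (lead_coeff p) (\<Prod>x\<in>#A. [:-x, 1:])"
    using alg_closed_imp_factorization[OF p] by blast
  have nz: "(\<Prod>x\<in>#B. [:-x, 1:]) \<noteq> 0" for B :: "'a multiset"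
    by (induction B) (auto simp del: mult_pCons_left)
  have "proots p = proots (\<Prod>x\<in>#A. [:-x, 1:])"
    using p by (subst A(2)) (simp del: proots_mult)
  also have "\<dots> = A"
  proof (induction A)
    case (add x A)
    have "proots ([:-x, 1:] * (\<Prod>x\<in>#A. [:-x, 1:])) = proots [:-x, 1:] + proots (\<Prod>x\<in>#A. [:-x, 1:])"
      using nz[of A] by (intro proots_mult) auto
    with add show ?case by (simp del: mult_pCons_left)
  qed simp
  finally have "proots p = A" .
  \<comment> \<open>A multiple root would also be a root of the derivative.\<close>
  moreover have "count (proots p) x \<le> 1" for x
  proof (rule ccontr)
    assume "\<not> count (proots p) x \<le> 1"
    then have "[:-x, 1:] ^ 2 dvd p"
      using p order_divides[of x 2 p] by simp
    then obtain q where "p = [:-x, 1:] ^ 2 * q" ..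
    then have "p = [:-x, 1:] * ([:-x, 1:] * q)" by (simp only: power2_eq_square mult.assoc)
    then have "poly p x = 0" "poly (pderiv p) x = 0"
      by (simp_all add: pderiv_mult del: mult_pCons_left)
    with sep show False by blast
  qed
  ultimately have "count A x \<le> 1" for x by simp
  then have "mset_set (set_mset A) = A"
    by (intro multiset_eqI)
      (metis One_nat_def count_greater_zero_iff count_inI count_mset_set(1,3) finite_set_mset
        le_antisym Suc_leI)
  then have "card (set_mset A) = size A" by (metis size_mset_set)
  then show ?thesis using A(1) \<open>proots p = A\<close> p by (metis set_count_proots)
qed

text \<open>The derivative of \<open>X^(2^m) - X\<close> is the constant -1, so its roots are
  simple. For \<open>m = 0\<close> the polynomial would be zero.\<close>

lemma card_GF2:
  assumes "m > 0"
  shows "card (GF2 m) = 2 ^ m"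
proof -
  define p :: "bit alg_closure poly" where "p = monom 1 (2 ^ m) - monom 1 1"
  have two: "(of_nat (2 ^ m) :: bit alg_closure) = 0"
    using assms by (metis ac_add_self one_add_one of_nat_numeral of_nat_power zero_power)
  have "pderiv p = - 1"
    unfolding p_def pderiv_diff pderiv_monom two by simp
  then have "p \<noteq> 0" by auto
  have "degree p = 2 ^ m"
    unfolding p_def diff_conv_add_uminus using assms one_less_power[of "2::nat" m]
    by (subst degree_add_eq_left) (simp_all add: degree_monom_eq)
  moreover have "{x. poly p x = 0} = GF2 m"
    by (auto simp: p_def GF2_def poly_monom)
  ultimately show ?thesis
    using card_roots_separable[of p] \<open>p \<noteq> 0\<close> \<open>pderiv p = - 1\<close> by simp
qed

lemma finite_GF2: "m > 0 \<Longrightarrow> finite (GF2 m)"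
  by (rule card_ge_0_finite) (simp add: card_GF2)

lemma GF2_sqrt:
  assumes "x \<in> GF2 m" "m > 0"
  shows "\<exists>y \<in> GF2 m. y ^ 2 = x"
proof (intro bexI)
  show "(x ^ (2 ^ (m - 1))) ^ 2 = x"
    using assms by (simp add: GF2_iff flip: power_mult power_Suc2)
qed (use assms in simp)

section \<open>The trace\<close>

text \<open>Squaring permutes the conjugates cyclically, so their sum satisfies
  \<open>s^2 = s\<close> and is 0 or 1; this justifies the definite description in
  \<open>trace\<close>.\<close>

lemma to_ac_trace:
  assumes "x \<in> GF2 m"
  shows "to_ac (trace m x) = (\<Sum>i<m. x ^ (2 ^ i))"
proof -
  let ?s = "\<Sum>i<m. x ^ (2 ^ i)"
  have "?s ^ 2 = (\<Sum>i<m. x ^ (2 ^ Suc i))"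
    using frobenius_sum[of "\<lambda>i. x ^ (2 ^ i)" "{..<m}" 1] by (simp add: mult.commute flip: power_mult)
  also have "\<dots> + x = ?s + x ^ (2 ^ m)"
    using sum.lessThan_Suc_shift[of "\<lambda>i. x ^ (2 ^ i)" m]
      sum.lessThan_Suc[of "\<lambda>i. x ^ (2 ^ i)" m] by (simp add: add.commute)
  finally have "?s ^ 2 = ?s" using assms by (simp add: GF2_iff)
  then have "?s * (?s - 1) = 0" by (simp add: algebra_simps power2_eq_square)
  then have "?s = to_ac 0 \<or> ?s = to_ac 1" by simp
  then obtain b where b: "to_ac b = ?s" by metis
  then show ?thesis unfolding trace_def
    by (rule theI[where P = "\<lambda>b. to_ac b = ?s"]) (metis b to_ac_eq_iff)
qed

lemma trace_0 [simp]: "trace m 0 = 0"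
proof -
  have "to_ac (trace m 0) = to_ac 0" by (subst to_ac_trace) (simp_all add: power_0_left)
  then show ?thesis by (simp only: to_ac_eq_iff)
qed

lemma trace_add:
  assumes "x \<in> GF2 m" "y \<in> GF2 m"
  shows "trace m (x + y) = trace m x + trace m y"
proof -
  have "to_ac (trace m (x + y)) = to_ac (trace m x + trace m y)"
    using assms by (simp add: to_ac_trace frobenius_add sum.distrib)
  then show ?thesis by (simp only: to_ac_eq_iff)
qed

lemma trace_sum:
  assumes "\<And>i. i \<in> A \<Longrightarrow> f i \<in> GF2 m"
  shows "trace m (sum f A) = (\<Sum>i\<in>A. trace m (f i))"
  using assms
  by (induction A rule: infinite_finite_induct) (simp_all add: trace_add GF2_sum)

lemma trace_frobenius:
  assumes x: "x \<in> GF2 m"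
  shows "trace m (x ^ (2 ^ k)) = trace m x"
proof -
  have sq: "trace m (y ^ 2) = trace m y" if y: "y \<in> GF2 m" for y
  proof -
    have "to_ac (trace m (y ^ 2)) + y = (\<Sum>i<m. y ^ (2 ^ Suc i)) + y"
      using y by (simp add: to_ac_trace flip: power_mult)
    also have "\<dots> = (\<Sum>i<m. y ^ (2 ^ i)) + y ^ (2 ^ m)"
      using sum.lessThan_Suc_shift[of "\<lambda>i. y ^ (2 ^ i)" m]
        sum.lessThan_Suc[of "\<lambda>i. y ^ (2 ^ i)" m] by (simp add: add.commute)
    also have "\<dots> = to_ac (trace m y) + y" using y by (simp add: to_ac_trace GF2_iff)
    finally show ?thesis by simp
  qed
  show ?thesis
  proof (induction k)
    case (Suc k)
    have "x ^ (2 ^ Suc k) = (x ^ (2 ^ k)) ^ 2" by (simp add: mult.commute flip: power_mult)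
    with sq[of "x ^ (2 ^ k)"] Suc x show ?case by simp
  qed simp
qed

lemma trace_to_ac_mult:
  assumes "x \<in> GF2 m"
  shows "trace m (to_ac b * x) = b * trace m x"
  by (cases b) simp_all

text \<open>The trace is a nonzero polynomial of degree below \<open>2^m\<close>, so it cannot
  vanish at \<open>2^m\<close> points.\<close>

lemma trace_nonzero:
  assumes "m > 0"
  shows "\<exists>x \<in> GF2 m. trace m x = 1"
proof (rule ccontr)
  assume "\<not> (\<exists>x \<in> GF2 m. trace m x = 1)"
  then have z: "to_ac (trace m x) = 0" if "x \<in> GF2 m" for x
    using that by (metis bit_not_one_iff to_ac_0)
  define p :: "bit alg_closure poly" where "p = (\<Sum>i<m. monom 1 (2 ^ i))"
  have "coeff p 1 = (\<Sum>i<m. if i = 0 then 1 else 0)"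
    unfolding p_def coeff_sum by (intro sum.cong) auto
  then have "coeff p 1 = 1" using assms by simp
  then have "p \<noteq> 0" by auto
  have "degree p \<le> 2 ^ (m - 1)"
    unfolding p_def
    by (rule degree_sum_le) (auto simp: degree_monom_eq intro: power_increasing)
  also have "\<dots> < 2 ^ m" using assms by simp
  finally have deg: "degree p < 2 ^ m" .
  have "GF2 m \<subseteq> {x. poly p x = 0}"
    using z by (auto simp: p_def poly_sum poly_monom to_ac_trace)
  then have "card (GF2 m) \<le> degree p"
    using card_poly_roots_bound[OF \<open>p \<noteq> 0\<close>] card_mono[OF poly_roots_finite[OF \<open>p \<noteq> 0\<close>]]
    by (meson order_trans)
  then show False using deg assms by (simp add: card_GF2)
qed

lemma trace_nondegenerate:
  assumes "m > 0" "c \<in> GF2 m" "c \<noteq> 0"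
  shows "\<exists>x \<in> GF2 m. trace m (c * x) = 1"
proof -
  obtain y where y: "y \<in> GF2 m" "trace m y = 1" using trace_nonzero assms by blast
  then have "c * (inverse c * y) = y" using assms by (simp add: field_simps)
  with y assms show ?thesis by (metis GF2_inverse GF2_mult)
qed

section \<open>The Kerdock quadratic form\<close>

lemma Q_0 [simp]: "Q m 0 = 0"
  by (simp add: Q_def)

text \<open>With \<open>m = 2r + 1\<close>, the polarization of \<open>Q\<close> has exponents
  \<open>j\<close> and, after \<open>swap\<close>, \<open>m - j\<close> for \<open>j\<close> from 1
  to \<open>r\<close>; together they run exactly once through 1 to \<open>m - 1\<close>.\<close>

lemma Q_add:
  assumes x: "x \<in> GF2 m" and y: "y \<in> GF2 m" and "odd m"
  shows "Q m (x + y) = Q m x + Q m y + trace m x * trace m y + trace m (x * y)"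
proof -
  define r where "r = (m - 1) div 2"
  have m: "m = Suc (2 * r)" using \<open>odd m\<close> by (auto simp: r_def elim!: oddE)
  \<comment> \<open>Applying the Frobenius map \<open>m - j\<close> times preserves the trace and
    turns \<open>x ^ (2 ^ j)\<close> into \<open>x ^ (2 ^ m) = x\<close>.\<close>
  have swap: "trace m (x ^ (2 ^ j) * y) = trace m (x * y ^ (2 ^ (m - j)))" if "j \<le> m" for j
  proof -
    have "trace m (x ^ (2 ^ j) * y) = trace m ((x ^ (2 ^ j) * y) ^ (2 ^ (m - j)))"
      using x y by (intro trace_frobenius[symmetric]) simp
    also have "(x ^ (2 ^ j) * y) ^ (2 ^ (m - j)) = x ^ (2 ^ m) * y ^ (2 ^ (m - j))"
      using that by (simp add: power_mult_distrib flip: power_mult power_add)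
    finally show ?thesis using x by (simp add: GF2_iff)
  qed
  have expand: "trace m ((x + y) ^ (1 + 2 ^ j)) = trace m (x ^ (1 + 2 ^ j)) + trace m (y ^ (1 + 2 ^ j))
      + (trace m (x * y ^ (2 ^ j)) + trace m (x ^ (2 ^ j) * y))" for j
  proof -
    have "(x + y) ^ (1 + 2 ^ j) = x ^ (1 + 2 ^ j) + y ^ (1 + 2 ^ j) + (x * y ^ (2 ^ j) + x ^ (2 ^ j) * y)"
      by (simp add: frobenius_add algebra_simps)
    then show ?thesis using x y by (simp add: trace_add del: power_Suc)
  qed
  have "Q m (x + y) = Q m x + Q m y
      + (\<Sum>j = 1..r. trace m (x * y ^ (2 ^ j)) + trace m (x ^ (2 ^ j) * y))"
    unfolding Q_def r_def[symmetric] expand sum.distrib by simp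
  also have "(\<Sum>j = 1..r. trace m (x * y ^ (2 ^ j)) + trace m (x ^ (2 ^ j) * y))
      = (\<Sum>j = 1..r. trace m (x * y ^ (2 ^ j))) + (\<Sum>j = 1..r. trace m (x * y ^ (2 ^ (m - j))))"
    unfolding sum.distrib[symmetric]
    by (intro sum.cong refl arg_cong2[of _ _ _ _ "(+)"] swap) (simp add: m)
  also have "(\<Sum>j = 1..r. trace m (x * y ^ (2 ^ (m - j)))) = (\<Sum>j = Suc r..2 * r. trace m (x * y ^ (2 ^ j)))"
    by (rule sum.reindex_bij_witness[of _ "\<lambda>j. m - j" "\<lambda>j. m - j"]) (auto simp: m)
  also have "(\<Sum>j = 1..r. trace m (x * y ^ (2 ^ j))) + \<dots> = (\<Sum>j = 1..2 * r. trace m (x * y ^ (2 ^ j)))"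
    using sum.ub_add_nat[of 1 r "\<lambda>j. trace m (x * y ^ (2 ^ j))" r] by (simp add: mult_2)
  \<comment> \<open>The sum over all \<open>j < m\<close> is the trace of \<open>x\<close> times the
    bit tr(y); the present range lacks only \<open>j = 0\<close>, which is tr(x y).\<close>
  also have "\<dots> = trace m x * trace m y + trace m (x * y)"
  proof -
    have "(\<Sum>j<m. trace m (x * y ^ (2 ^ j))) = trace m (\<Sum>j<m. x * y ^ (2 ^ j))"
      using x y by (intro trace_sum[symmetric]) simp
    also have "(\<Sum>j<m. x * y ^ (2 ^ j)) = to_ac (trace m y) * x"
      using y by (simp add: to_ac_trace sum_distrib_left mult.commute)
    also have "trace m \<dots> = trace m x * trace m y"
      using trace_to_ac_mult[OF x, of "trace m y"] by (simp only: mult.commute)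
    finally have "(\<Sum>j<m. trace m (x * y ^ (2 ^ j))) = trace m x * trace m y" .
    moreover have "(\<Sum>j<m. trace m (x * y ^ (2 ^ j)))
        = trace m (x * y) + (\<Sum>j = 1..2 * r. trace m (x * y ^ (2 ^ j)))"
      unfolding m sum.lessThan_Suc_shift
      by (simp add: sum.atLeast1_atMost_eq)
    ultimately have "trace m (x * y) + (trace m (x * y) + (\<Sum>j = 1..2 * r. trace m (x * y ^ (2 ^ j))))
        = trace m (x * y) + trace m x * trace m y" by simp
    then show ?thesis by (simp only: add.assoc[symmetric] bit_plus_self add_0_left add.commute)
  qed
  finally show ?thesis by (simp add: add.assoc)
qed

text \<open>For odd \<open>m\<close> this is the trace from the Galois ring GR(4,m) of the
  Teichmueller representative of \<open>x\<close>: squaring that trace shows its high digit to be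
  the sum of \<open>x^(2^i + 2^j)\<close> over \<open>i < j < m\<close>, which groups into the
  traces in \<open>Q\<close>.\<close>

definition quad :: "nat \<Rightarrow> bit alg_closure \<Rightarrow> z4" where
  "quad m x = lift_bit (trace m x) + twice_bit (Q m x)"

lemma red2_quad [simp]: "red2 (quad m x) = trace m x"
  by (simp add: quad_def)

lemma quad_0 [simp]: "quad m 0 = 0"
  by (simp add: quad_def)

text \<open>The carry \<open>trace m x * trace m y\<close> from \<open>lift_bit_add\<close> meets
  the same product from \<open>Q_add\<close>; they cancel and only the bilinear form
  remains.\<close>

lemma quad_add:
  assumes "x \<in> GF2 m" "y \<in> GF2 m" "odd m"
  shows "quad m (x + y) = quad m x + quad m y + twice_bit (trace m (x * y))"
proof -
  have cancel: "twice_bit c + twice_bit c = 0" for c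
    by (simp flip: twice_bit_add)
  show ?thesis
    using assms cancel[of "trace m x * trace m y"]
    by (simp add: quad_def trace_add Q_add lift_bit_add twice_bit_add algebra_simps)
qed


section \<open>Quaternary Kerdock words\<close>

lemma z4_double: "x + x = twice_bit (red2 x)"
  using z4_cases[of x] by (auto simp: red2_def twice_bit_def)

definition word :: "nat \<Rightarrow> bit alg_closure \<Rightarrow> bit alg_closure \<Rightarrow> z4 \<Rightarrow> bit alg_closure \<Rightarrow> z4" where
  "word m a b e x = quad m (a * x) + twice_bit (trace m (b * x)) + e"

text \<open>
  The cross term \<open>2 tr(a a' x\<^sup>2)\<close> equals \<open>2 tr(s x)\<close> for \<open>s\<^sup>2 = a a'\<close>, so it is linear in \<open>x\<close>.
\<close>

lemma word_diff:
  assumes ab: "a \<in> GF2 m" "b \<in> GF2 m" "a' \<in> GF2 m" "b' \<in> GF2 m" and m: "odd m"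
  shows "\<exists>b'' \<in> GF2 m. (a = a' \<longrightarrow> b'' = b + b') \<and>
    (\<forall>x \<in> GF2 m. word m a b e x - word m a' b' e' x = word m (a + a') b'' (e - e') x)"
proof (cases "a = a'")
  \<comment> \<open>Equal quadratic parts cancel outright, leaving exactly \<open>b + b'\<close>;
    the injectivity of the parametrization will rest on this value.\<close>
  case True
  have "word m a b e x - word m a' b' e' x = word m (a + a') (b + b') (e - e') x"
    if "x \<in> GF2 m" for x
  proof -
    have "twice_bit (trace m ((b + b') * x))
        = twice_bit (trace m (b * x)) + - twice_bit (trace m (b' * x))"
      unfolding twice_bit_uminus using that ab by (simp add: distrib_right trace_add twice_bit_add)
    then show ?thesis by (simp add: word_def True)
  qed
  with True ab show ?thesis by (intro bexI[of _ "b + b'"]) simp_all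
next
  case False
  obtain s where s: "s \<in> GF2 m" "s ^ 2 = a * a'"
    using GF2_sqrt[of "a * a'" m] ab m by (auto simp: odd_pos)
  \<comment> \<open>The summand \<open>a'\<close> turns subtraction into addition:
    \<open>- y = y + twice_bit (red2 y)\<close>, so -q(a'x) = q(a'x) + 2 tr(a'x).\<close>
  have "word m a b e x - word m a' b' e' x = word m (a + a') (b + b' + s + a') (e - e') x"
    if x: "x \<in> GF2 m" for x
  proof -
    have alg: "A + B + e - (A' + B' + e') = A + A' + S + (B + B' + S + U) + (e - e')"
      if "A' + A' = U" "S + S = 0" "B' + B' = 0" "U + U = 0" for A A' B B' S U :: z4
    proof -
      have "A + A' + S + (B + B' + S + U) + (e - e')
          = A + B + e - (A' + B' + e') + ((A' + A') + U + (S + S) + (B' + B'))"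
        by (simp only: algebra_simps)
      then show ?thesis by (simp only: that add_0_right)
    qed
    have "quad m (a * x + a' * x) = quad m (a * x) + quad m (a' * x) + twice_bit (trace m (a * x * (a' * x)))"
      using ab x m by (intro quad_add) simp_all
    also have "a * x * (a' * x) = (s * x) ^ (2 ^ 1)"
      by (simp only: power_one_right power_mult_distrib s power2_eq_square[of x] mult_ac)
    also have "trace m ((s * x) ^ (2 ^ 1)) = trace m (s * x)"
      using s x by (intro trace_frobenius) simp
    finally have "quad m ((a + a') * x) = quad m (a * x) + quad m (a' * x) + twice_bit (trace m (s * x))"
      by (simp only: distrib_right)
    moreover have "twice_bit (trace m ((b + b' + s + a') * x)) = twice_bit (trace m (b * x))
        + twice_bit (trace m (b' * x)) + twice_bit (trace m (s * x)) + twice_bit (trace m (a' * x))"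
      using ab x s by (simp add: distrib_right trace_add twice_bit_add)
    ultimately show ?thesis
      unfolding word_def by (simp only:) (rule alg; simp add: z4_double)
  qed
  with False ab s show ?thesis by (intro bexI[of _ "b + b' + s + a'"]) simp_all
qed

text \<open>Written as \<open>u - (0 - v)\<close>, with two uses of
  \<open>word_diff\<close>.\<close>

lemma word_add:
  assumes ab: "a \<in> GF2 m" "b \<in> GF2 m" "a' \<in> GF2 m" "b' \<in> GF2 m" and m: "odd m"
  shows "\<exists>b'' \<in> GF2 m. \<forall>x \<in> GF2 m.
    word m a b e x + word m a' b' e' x = word m (a + a') b'' (e + e') x"
proof -
  obtain c where c: "c \<in> GF2 m"
    "\<And>x. x \<in> GF2 m \<Longrightarrow> word m 0 0 0 x - word m a' b' e' x = word m a' c (- e') x"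
    using word_diff[of 0 m 0 a' b' 0 e'] ab m by auto
  obtain b'' where b'': "b'' \<in> GF2 m"
    "\<And>x. x \<in> GF2 m \<Longrightarrow> word m a b e x - word m a' c (- e') x = word m (a + a') b'' (e - - e') x"
    using word_diff[of a m b a' c e "- e'"] ab c m by blast
  have "word m 0 0 0 x = 0" for x by (simp add: word_def)
  with c b'' show ?thesis by (intro bexI[of _ b'']) (simp_all flip: b''(2) c(2))
qed

section \<open>Character sums\<close>

definition chi :: "z4 \<Rightarrow> complex" where
  "chi x = (if x = 0 then 1 else if x = 1 then \<i> else if x = 2 then - 1 else - \<i>)"

lemma chi_0 [simp]: "chi 0 = 1"
  by (simp add: chi_def)

lemma chi_add: "chi (x + y) = chi x * chi y"
  using z4_cases[of x] z4_cases[of y] by (auto simp: chi_def)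

lemma cnj_chi: "cnj (chi x) = chi (- x)"
  using z4_cases[of x] by (auto simp: chi_def)

lemma chi_twice_bit: "chi (twice_bit b) = (if b = 0 then 1 else - 1)"
  by (cases b) (simp_all add: chi_def twice_bit_def)

lemma chi_gaussian: "\<exists>a b :: int. chi x = Complex (of_int a) (of_int b)"
proof -
  have "1 = Complex (of_int 1) (of_int 0)" "\<i> = Complex (of_int 0) (of_int 1)"
    "- 1 = Complex (of_int (- 1)) (of_int 0)" "- \<i> = Complex (of_int 0) (of_int (- 1))"
    by (simp_all add: complex_eq_iff)
  then show ?thesis unfolding chi_def by metis
qed

lemma Re_chi_le: "e \<noteq> 0 \<Longrightarrow> Re (chi e) \<le> 0"
  by (simp add: chi_def)

text \<open>The Gray map is an isometry: the Lee weights 0, 1, 2, 1 of the difference are one minus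
  the real parts of the powers of \<i>.\<close>

lemma Re_chi_beta_gamma:
  "of_bool (\<beta> u \<noteq> \<beta> v) + of_bool (\<gamma> u \<noteq> \<gamma> v) = 1 - Re (chi (u - v))"
  using z4_cases[of u] z4_cases[of v] by (auto simp: chi_def \<beta>_def \<gamma>_def)

lemma sum_GF2_translate:
  assumes "c \<in> GF2 m"
  shows "(\<Sum>x\<in>GF2 m. f (x + c)) = (\<Sum>x\<in>GF2 m. f x)"
  by (rule sum.reindex_bij_witness[of _ "\<lambda>x. x + c" "\<lambda>x. x + c"])
    (use assms in \<open>simp_all add: add.assoc\<close>)

text \<open>Translation by a point of trace form 1 negates every summand.\<close>

lemma sum_chi_trace:
  assumes "m > 0" "c \<in> GF2 m" "c \<noteq> 0"
  shows "(\<Sum>x\<in>GF2 m. chi (twice_bit (trace m (c * x)))) = 0"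
proof -
  obtain x0 where x0: "x0 \<in> GF2 m" "trace m (c * x0) = 1"
    using trace_nondegenerate assms by blast
  let ?S = "\<Sum>x\<in>GF2 m. chi (twice_bit (trace m (c * x)))"
  have "?S = (\<Sum>x\<in>GF2 m. chi (twice_bit (trace m (c * (x + x0)))))"
    using x0 by (intro sum_GF2_translate[symmetric])
  also have "\<dots> = (\<Sum>x\<in>GF2 m. - chi (twice_bit (trace m (c * x))))"
    using x0 assms
    by (intro sum.cong) (simp_all add: distrib_left trace_add twice_bit_add chi_add chi_twice_bit)
  also have "\<dots> = - ?S" by (rule sum_negf)
  finally show ?thesis by simp
qed

definition char_sum :: "nat \<Rightarrow> bit alg_closure \<Rightarrow> bit alg_closure \<Rightarrow> z4 \<Rightarrow> complex" where
  "char_sum m a b e = (\<Sum>x\<in>GF2 m. chi (word m a b e x))"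

lemma char_sum_const: "char_sum m a b e = chi e * char_sum m a b 0"
  by (simp add: char_sum_def word_def chi_add sum_distrib_left mult.commute)

text \<open>
  Substituting \<open>x = y + z\<close> in the double sum for \<open>\<bar>S\<bar>\<^sup>2\<close> makes the inner sum over \<open>y\<close>
  a linear character sum, which vanishes unless \<open>z = 0\<close>.
\<close>

lemma char_sum_norm:
  assumes m: "odd m" and ab: "a \<in> GF2 m" "b \<in> GF2 m" "a \<noteq> 0"
  shows "char_sum m a b e * cnj (char_sum m a b e) = 2 ^ m"
proof -
  have pos: "m > 0" using m by (rule odd_pos)
  let ?F = "GF2 m" and ?w = "word m a b e"
  \<comment> \<open>What depends on \<open>y\<close> alone cancels, and the polar form in
    \<open>quad_add\<close> leaves one term linear in \<open>y\<close>.\<close>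
  have diff: "?w (z + y) - ?w y = word m a b 0 z + twice_bit (trace m (a ^ 2 * z * y))"
    if "y \<in> ?F" "z \<in> ?F" for y z
    using that ab m
    by (simp add: word_def distrib_left quad_add trace_add twice_bit_add power2_eq_square mult_ac)
  have "char_sum m a b e * cnj (char_sum m a b e) = (\<Sum>x\<in>?F. \<Sum>y\<in>?F. chi (?w x - ?w y))"
    unfolding char_sum_def cnj_sum sum_product cnj_chi
    by (simp flip: chi_add)
  also have "\<dots> = (\<Sum>y\<in>?F. \<Sum>x\<in>?F. chi (?w x - ?w y))"
    by (rule sum.swap)
  also have "\<dots> = (\<Sum>y\<in>?F. \<Sum>z\<in>?F. chi (?w (z + y) - ?w y))"
    by (intro sum.cong refl sum_GF2_translate[symmetric])
  also have "\<dots> = (\<Sum>y\<in>?F. \<Sum>z\<in>?F. chi (word m a b 0 z) * chi (twice_bit (trace m (a ^ 2 * z * y))))"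
    by (intro sum.cong refl) (simp add: diff chi_add)
  also have "\<dots> = (\<Sum>z\<in>?F. chi (word m a b 0 z) * (\<Sum>y\<in>?F. chi (twice_bit (trace m (a ^ 2 * z * y)))))"
    unfolding sum_distrib_left by (rule sum.swap)
  also have "\<dots> = (\<Sum>z\<in>?F. if z = 0 then 2 ^ m else 0)"
  proof (intro sum.cong refl)
    fix z assume z: "z \<in> ?F"
    show "chi (word m a b 0 z) * (\<Sum>y\<in>?F. chi (twice_bit (trace m (a ^ 2 * z * y))))
        = (if z = 0 then 2 ^ m else 0)"
    proof (cases "z = 0")
      case True
      then show ?thesis using pos by (simp add: word_def card_GF2)
    next
      case False
      then have "(\<Sum>y\<in>?F. chi (twice_bit (trace m (a ^ 2 * z * y)))) = 0"
        using pos ab z by (intro sum_chi_trace) simp_all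
      with False show ?thesis by simp
    qed
  qed
  also have "\<dots> = 2 ^ m" using pos by (simp add: finite_GF2)
  finally show ?thesis .
qed

text \<open>Descent: from exponent 3 on the sum is divisible by 4, whereas two odd squares add up to
  2 modulo 4. So both numbers are even, and halving them lowers the exponent by 2, down to 1 + 1 =
  2.\<close>

lemma sum_two_squares_eq_power2:
  fixes a b :: int
  assumes "a ^ 2 + b ^ 2 = 2 ^ (2 * r + 1)"
  shows "\<bar>a\<bar> = 2 ^ r"
  using assms
proof (induction r arbitrary: a b)
  case 0
  have "a ^ 2 + b ^ 2 = 2" using 0 by simp
  moreover have "0 \<le> a ^ 2" "0 \<le> b ^ 2" by simp_all
  ultimately have "a ^ 2 \<le> 2" "b ^ 2 \<le> 2" by linarith+
  then have "\<bar>a\<bar> < 2" "\<bar>b\<bar> < 2"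
    using power2_le_iff_abs_le[of 2 a] abs_le_square_iff[of 2 a] abs_le_square_iff[of 2 b]
    by (auto simp: not_less[symmetric])
  then have "a \<in> {-1, 0, 1}" "b \<in> {-1, 0, 1}" by auto
  then show ?case using 0 by auto
next
  case (Suc r)
  have "even (a ^ 2 + b ^ 2)" unfolding Suc.prems by simp
  then have "even (a + b)" by simp
  have "a ^ 2 + b ^ 2 = 4 * 2 ^ (2 * r + 1)" using Suc.prems by simp
  have "even a \<and> even b"
  proof (rule ccontr)
    assume "\<not> (even a \<and> even b)"
    with \<open>even (a + b)\<close> have "odd a" "odd b" by auto
    then obtain c d where "a = 2 * c + 1" "b = 2 * d + 1" by (auto elim!: oddE)
    then have "a ^ 2 + b ^ 2 = 4 * (c ^ 2 + c + d ^ 2 + d) + 2"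
      by (simp add: power2_eq_square algebra_simps)
    with \<open>a ^ 2 + b ^ 2 = 4 * 2 ^ (2 * r + 1)\<close> show False by presburger
  qed
  then obtain c d where cd: "a = 2 * c" "b = 2 * d" by (auto elim!: evenE)
  with Suc.prems have "c ^ 2 + d ^ 2 = 2 ^ (2 * r + 1)" by (simp add: power_mult_distrib)
  then have "\<bar>c\<bar> = 2 ^ r" by (rule Suc.IH)
  then show ?case by (simp add: cd abs_mult)
qed

lemma Re_char_sum:
  assumes m: "odd m" and ab: "a \<in> GF2 m" "b \<in> GF2 m" "a \<noteq> 0"
  shows "\<bar>Re (char_sum m a b e)\<bar> = 2 ^ ((m - 1) div 2)"
proof -
  have "\<exists>c d :: int. (\<Sum>x\<in>A. chi (word m a b e x)) = Complex (of_int c) (of_int d)" for A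
  proof (induction A rule: infinite_finite_induct)
    case (insert x A)
    obtain c d c' d' :: int where
      "(\<Sum>x\<in>A. chi (word m a b e x)) = Complex (of_int c) (of_int d)"
      "chi (word m a b e x) = Complex (of_int c') (of_int d')"
      using insert.IH chi_gaussian by blast
    then have "(\<Sum>x\<in>insert x A. chi (word m a b e x)) = Complex (of_int (c' + c)) (of_int (d' + d))"
      using insert by (simp add: complex_eq_iff)
    then show ?case by blast
  qed (auto simp: complex_eq_iff intro: exI[of _ "0::int"])
  then obtain c d :: int where cd: "char_sum m a b e = Complex (of_int c) (of_int d)"
    unfolding char_sum_def by blast
  have "complex_of_real (real_of_int (c ^ 2 + d ^ 2)) = complex_of_real (2 ^ m)"
    using char_sum_norm[OF m ab, of e] unfolding cd by (simp add: complex_mult_cnj)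
  then have "real_of_int (c ^ 2 + d ^ 2) = real_of_int (2 ^ m)"
    by (simp only: of_real_eq_iff of_int_power of_int_numeral)
  then have "c ^ 2 + d ^ 2 = 2 ^ m" by (simp only: of_int_eq_iff)
  moreover have "m = 2 * ((m - 1) div 2) + 1" using m by (auto elim!: oddE)
  ultimately have "\<bar>c\<bar> = 2 ^ ((m - 1) div 2)" using sum_two_squares_eq_power2 by metis
  then have "real_of_int \<bar>c\<bar> = real_of_int (2 ^ ((m - 1) div 2))" by (simp only:)
  then show ?thesis by (simp add: cd)
qed

text \<open>For \<open>a = 0\<close> and \<open>b \<noteq> 0\<close> the sum is a nontrivial linear
  character sum, hence 0; for \<open>a = b = 0\<close> it is \<open>2^m * chi e\<close> with
  \<open>e \<noteq> 0\<close>, whose real part is at most 0.\<close>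

lemma Re_char_sum_le:
  assumes m: "odd m" and ab: "a \<in> GF2 m" "b \<in> GF2 m" and nz: "(a, b, e) \<noteq> (0, 0, 0)"
  shows "Re (char_sum m a b e) \<le> 2 ^ ((m - 1) div 2)"
proof (cases "a = 0")
  case False
  then show ?thesis using Re_char_sum[OF m ab, of e] by simp
next
  case True
  have "Re (char_sum m a b e) \<le> 0"
  proof (cases "b = 0")
    case False
    then have "char_sum m a b 0 = 0"
      using True sum_chi_trace[of m b] ab m by (simp add: char_sum_def word_def odd_pos)
    then show ?thesis using char_sum_const[of m a b e] by simp
  next
    case b: True
    then show ?thesis
      using True nz m by (simp add: char_sum_def word_def card_GF2 odd_pos Re_chi_le mult_nonneg_nonpos)
  qed
  also have "0 \<le> (2 :: real) ^ ((m - 1) div 2)" by simp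
  finally show ?thesis .
qed

section \<open>Distances\<close>

lemma hamming_distance_phi:
  assumes "distinct xs"
  shows "real (hamming_distance (\<phi> (map f xs)) (\<phi> (map g xs)))
    = real (length xs) - Re (\<Sum>x\<in>set xs. chi (f x - g x))"
proof -
  have split: "(\<Sum>i<N + M. h i) = (\<Sum>i<N. h i) + (\<Sum>i<M. h (i + N))"
    for h :: "nat \<Rightarrow> real" and N M
    by (induction M) (simp_all add: add_ac)
  define N where "N = length xs"
  let ?D = "\<lambda>i. \<phi> (map f xs) ! i \<noteq> \<phi> (map g xs) ! i"
  have len: "length (\<phi> (map f xs)) = N + N" by (simp add: \<phi>_def N_def)
  have "hamming_distance (\<phi> (map f xs)) (\<phi> (map g xs)) = card {i \<in> {..<N + N}. ?D i}"
    unfolding hamming_distance_def len by (intro arg_cong[where f = card]) auto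
  also have "real \<dots> = (\<Sum>i<N + N. of_bool (?D i))"
    by (simp add: Int_def)
  \<comment> \<open>Coordinates \<open>i\<close> and \<open>i + N\<close> are paired because both
    come from the same quaternary symbol.\<close>
  also have "\<dots> = (\<Sum>i<N. of_bool (?D i)) + (\<Sum>i<N. of_bool (?D (i + N)))"
    by (rule split)
  also have "\<dots> = (\<Sum>i<N. 1 - Re (chi (f (xs ! i) - g (xs ! i))))"
    unfolding sum.distrib[symmetric]
  proof (intro sum.cong refl)
    fix i assume "i \<in> {..<N}"
    then have "?D i \<longleftrightarrow> \<beta> (f (xs ! i)) \<noteq> \<beta> (g (xs ! i))"
      "?D (i + N) \<longleftrightarrow> \<gamma> (f (xs ! i)) \<noteq> \<gamma> (g (xs ! i))"
      by (simp_all add: \<phi>_def N_def nth_append)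
    then show "of_bool (?D i) + of_bool (?D (i + N)) = 1 - Re (chi (f (xs ! i) - g (xs ! i)))"
      using Re_chi_beta_gamma[of "f (xs ! i)" "g (xs ! i)"] by (simp only:)
  qed
  also have "\<dots> = (\<Sum>x\<in>set xs. 1 - Re (chi (f x - g x)))"
    using sum.reindex_bij_betw[OF bij_betw_nth[OF assms refl refl], of "\<lambda>x. 1 - Re (chi (f x - g x))"]
    by (simp add: N_def)
  also have "\<dots> = real (length xs) - Re (\<Sum>x\<in>set xs. chi (f x - g x))"
    using distinct_card[OF assms] by (simp add: sum_subtractf)
  finally show ?thesis .
qed

section \<open>Distances and size of the quaternary Kerdock words\<close>

definition quaternary_kerdock :: "nat \<Rightarrow> bit alg_closure list \<Rightarrow> z4 list set" where
  "quaternary_kerdock m xs = (\<lambda>(a, b, e). map (word m a b e) xs) ` (GF2 m \<times> GF2 m \<times> UNIV)"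

text \<open>The difference of two words is again a word, so the distance is \<open>2^m\<close> minus
  the real part of a single character sum.\<close>

lemma hamming_distance_words:
  assumes m: "odd m" and xs: "distinct xs" "set xs = GF2 m"
    and ab: "a \<in> GF2 m" "b \<in> GF2 m" "a' \<in> GF2 m" "b' \<in> GF2 m"
    and ne: "(a, b, e) \<noteq> (a', b', e')"
  shows "2 ^ m - 2 ^ ((m - 1) div 2)
    \<le> hamming_distance (\<phi> (map (word m a b e) xs)) (\<phi> (map (word m a' b' e') xs))"
proof -
  obtain b'' where b'': "b'' \<in> GF2 m" "a = a' \<longrightarrow> b'' = b + b'"
    "\<And>x. x \<in> GF2 m \<Longrightarrow> word m a b e x - word m a' b' e' x = word m (a + a') b'' (e - e') x"
    using word_diff[OF ab m, of e e'] by blast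
  have "length xs = 2 ^ m"
    using distinct_card[OF xs(1)] xs(2) card_GF2[of m] m by (simp add: odd_pos)
  then have "real (hamming_distance (\<phi> (map (word m a b e) xs)) (\<phi> (map (word m a' b' e') xs)))
      = 2 ^ m - Re (char_sum m (a + a') b'' (e - e'))"
    unfolding hamming_distance_phi[OF xs(1)] char_sum_def xs(2) by (simp add: b''(3))
  moreover have "(a + a', b'', e - e') \<noteq> (0, 0, 0)"
  proof
    assume z: "(a + a', b'', e - e') = (0, 0, 0)"
    have eq: "x = y" if "x + y = 0" for x y :: "bit alg_closure"
      using that by (simp flip: ac_diff_eq_add)
    from z eq have "a = a'" "e = e'" by auto
    with z b''(2) eq have "b = b'" by simp
    with \<open>a = a'\<close> \<open>e = e'\<close> ne show False by simp
  qed
  then have "Re (char_sum m (a + a') b'' (e - e')) \<le> 2 ^ ((m - 1) div 2)"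
    using ab b''(1) m by (intro Re_char_sum_le) simp_all
  \<comment> \<open>The bound is phrased additively before the return to natural numbers, where
    subtraction truncates.\<close>
  ultimately have "2 ^ m \<le> real (2 ^ ((m - 1) div 2)
      + hamming_distance (\<phi> (map (word m a b e) xs)) (\<phi> (map (word m a' b' e') xs)))"
    by simp
  then have "real (2 ^ m) \<le> real (2 ^ ((m - 1) div 2)
      + hamming_distance (\<phi> (map (word m a b e) xs)) (\<phi> (map (word m a' b' e') xs)))"
    by simp
  then have "2 ^ m \<le> 2 ^ ((m - 1) div 2)
      + hamming_distance (\<phi> (map (word m a b e) xs)) (\<phi> (map (word m a' b' e') xs))"
    by (simp only: of_nat_le_iff)
  then show ?thesis by linarith
qed

text \<open>For \<open>e = 0\<close> the real part is extremal up to sign; passing to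
  \<open>e = 2\<close> negates the sum, so one of the two choices has the positive sign.\<close>

lemma hamming_distance_attained:
  assumes m: "odd m" and xs: "distinct xs" "set xs = GF2 m"
  shows "\<exists>e. hamming_distance (\<phi> (map (word m 1 0 e) xs)) (\<phi> (map (word m 0 0 0) xs))
    = 2 ^ m - 2 ^ ((m - 1) div 2)"
proof -
  have len: "length xs = 2 ^ m"
    using distinct_card[OF xs(1)] xs(2) card_GF2[of m] m by (simp add: odd_pos)
  have *: "real (hamming_distance (\<phi> (map (word m 1 0 e) xs)) (\<phi> (map (word m 0 0 0) xs)))
      = 2 ^ m - Re (char_sum m 1 0 e)" for e
    unfolding hamming_distance_phi[OF xs(1)] char_sum_def xs(2) by (simp add: len word_def)
  have "\<bar>Re (char_sum m 1 0 0)\<bar> = 2 ^ ((m - 1) div 2)"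
    using Re_char_sum[OF m, of 1 0] by simp
  moreover have "char_sum m 1 0 2 = - char_sum m 1 0 0"
    using char_sum_const[of m 1 0 2] by (simp add: chi_def)
  ultimately have "Re (char_sum m 1 0 0) = 2 ^ ((m - 1) div 2) \<or>
      Re (char_sum m 1 0 2) = 2 ^ ((m - 1) div 2)"
    by (simp add: abs_if split: if_splits)
  then obtain e where "Re (char_sum m 1 0 e) = 2 ^ ((m - 1) div 2)" by blast
  with * have "real (hamming_distance (\<phi> (map (word m 1 0 e) xs)) (\<phi> (map (word m 0 0 0) xs)))
      + real (2 ^ ((m - 1) div 2)) = real (2 ^ m)" by simp
  then have "hamming_distance (\<phi> (map (word m 1 0 e) xs)) (\<phi> (map (word m 0 0 0) xs))
      + 2 ^ ((m - 1) div 2) = 2 ^ m" by (simp only: of_nat_add[symmetric] of_nat_eq_iff)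
  then have "hamming_distance (\<phi> (map (word m 1 0 e) xs)) (\<phi> (map (word m 0 0 0) xs))
      = 2 ^ m - 2 ^ ((m - 1) div 2)" by linarith
  then show ?thesis ..
qed

lemma hamming_distance_self [simp]: "hamming_distance u u = 0"
  by (simp add: hamming_distance_def)

lemma distance_bound_pos:
  assumes "odd m"
  shows "(0::nat) < 2 ^ m - 2 ^ ((m - 1) div 2)"
proof -
  have "(m - 1) div 2 < m" using assms by (auto elim!: oddE)
  then show ?thesis by simp
qed

text \<open>Distinct parameters give words at a distance bounded below by a positive number.\<close>

lemma inj_on_phi_words:
  assumes m: "odd m" and xs: "distinct xs" "set xs = GF2 m"
  shows "inj_on (\<lambda>(a, b, e). \<phi> (map (word m a b e) xs)) (GF2 m \<times> GF2 m \<times> UNIV)"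
proof -
  have key: "a = a' \<and> b = b' \<and> e = e'"
    if ab: "a \<in> GF2 m" "b \<in> GF2 m" "a' \<in> GF2 m" "b' \<in> GF2 m"
      and eq: "\<phi> (map (word m a b e) xs) = \<phi> (map (word m a' b' e') xs)" for a b e a' b' e'
  proof (rule ccontr)
    assume "\<not> (a = a' \<and> b = b' \<and> e = e')"
    then have "(a, b, e) \<noteq> (a', b', e')" by simp
    from hamming_distance_words[OF m xs ab this]
    have "2 ^ m - 2 ^ ((m - 1) div 2) \<le> (0 :: nat)" by (simp only: eq hamming_distance_self)
    with distance_bound_pos[OF m] show False by linarith
  qed
  show ?thesis
    by (rule inj_onI)
      (clarsimp simp only: mem_Times_iff fst_conv snd_conv prod.case, simp only: key prod.inject)
qed

lemma card_words: "odd m \<Longrightarrow> card (GF2 m \<times> GF2 m \<times> (UNIV :: z4 set)) = 2 ^ (2 * m + 2)"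
  by (simp add: card_cartesian_product card_GF2 odd_pos power_add mult_2)

lemma phi_quaternary_kerdock:
  "\<phi> ` quaternary_kerdock m xs = (\<lambda>(a, b, e). \<phi> (map (word m a b e) xs)) ` (GF2 m \<times> GF2 m \<times> UNIV)"
  unfolding quaternary_kerdock_def image_image by (simp add: case_prod_unfold)

lemma card_phi_quaternary_kerdock:
  assumes "odd m" "distinct xs" "set xs = GF2 m"
  shows "card (\<phi> ` quaternary_kerdock m xs) = 2 ^ (2 * m + 2)"
  unfolding phi_quaternary_kerdock
  using assms by (simp add: card_image inj_on_phi_words card_words)

lemma card_quaternary_kerdock:
  assumes "odd m" "distinct xs" "set xs = GF2 m"
  shows "card (quaternary_kerdock m xs) = 4 ^ (m + 1)"
proof -
  have fin: "finite (quaternary_kerdock m xs)"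
    unfolding quaternary_kerdock_def using assms by (simp add: finite_GF2 odd_pos)
  have "2 ^ (2 * m + 2) \<le> card (quaternary_kerdock m xs)"
    using card_phi_quaternary_kerdock[OF assms] card_image_le[OF fin, of \<phi>] by simp
  moreover have "card (quaternary_kerdock m xs) \<le> 2 ^ (2 * m + 2)"
    unfolding quaternary_kerdock_def card_words[OF assms(1), symmetric]
    using assms by (intro card_image_le) (simp add: finite_GF2 odd_pos)
  moreover have "(2::nat) ^ (2 * m + 2) = 4 ^ (m + 1)"
    by (simp add: power_mult power_add)
  ultimately show ?thesis by simp
qed

lemma minimal_distance_phi_quaternary_kerdock:
  assumes m: "odd m" and xs: "distinct xs" "set xs = GF2 m"
  shows "minimal_distance (\<phi> ` quaternary_kerdock m xs) = 2 ^ m - 2 ^ ((m - 1) div 2)"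
proof -
  let ?K = "\<phi> ` quaternary_kerdock m xs"
  let ?H = "{hamming_distance u v | u v. u \<in> ?K \<and> v \<in> ?K \<and> u \<noteq> v}"
  have fin: "finite ?K"
    unfolding phi_quaternary_kerdock using m by (simp add: finite_GF2 odd_pos)
  have "?H \<subseteq> (\<lambda>(u, v). hamming_distance u v) ` (?K \<times> ?K)" by auto
  then have "finite ?H" by (rule finite_subset) (simp add: fin)
  moreover have "2 ^ m - 2 ^ ((m - 1) div 2) \<in> ?H"
  proof -
    obtain e where e: "hamming_distance (\<phi> (map (word m 1 0 e) xs)) (\<phi> (map (word m 0 0 0) xs))
        = 2 ^ m - 2 ^ ((m - 1) div 2)"
      using hamming_distance_attained[OF m xs] by blast
    then have "\<phi> (map (word m 1 0 e) xs) \<noteq> \<phi> (map (word m 0 0 0) xs)"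
      using distance_bound_pos[OF m] by (metis hamming_distance_self less_irrefl)
    moreover have "\<phi> (map (word m a 0 e) xs) \<in> ?K" if "a \<in> GF2 m" for a e
      unfolding phi_quaternary_kerdock using that by (intro image_eqI[of _ _ "(a, 0, e)"]) simp_all
    ultimately show ?thesis unfolding mem_Collect_eq
      by (intro exI[of _ "\<phi> (map (word m 1 0 e) xs)"] exI[of _ "\<phi> (map (word m 0 0 0) xs)"])
        (simp only: e GF2_0 GF2_1 simp_thms)
  qed
  moreover have "2 ^ m - 2 ^ ((m - 1) div 2) \<le> d" if "d \<in> ?H" for d
  proof -
    from that obtain a b e a' b' e' where ab: "a \<in> GF2 m" "b \<in> GF2 m" "a' \<in> GF2 m" "b' \<in> GF2 m"
      and ne: "\<phi> (map (word m a b e) xs) \<noteq> \<phi> (map (word m a' b' e') xs)"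
      and d: "d = hamming_distance (\<phi> (map (word m a b e) xs)) (\<phi> (map (word m a' b' e') xs))"
      unfolding phi_quaternary_kerdock by auto
    from ne have "(a, b, e) \<noteq> (a', b', e')" by auto
    from hamming_distance_words[OF m xs ab this] show ?thesis by (simp add: d)
  qed
  ultimately show ?thesis unfolding minimal_distance_def by (intro Min_eqI) auto
qed


section \<open>The Gray image and the binary Kerdock code\<close>

lemma map2_pair_vec:
  "map2 (+) (pair_vec xs f1 f2) (pair_vec xs g1 g2) = pair_vec xs (\<lambda>x. f1 x + g1 x) (\<lambda>x. f2 x + g2 x)"
  by (simp add: pair_vec_def map2_map_map)

text \<open>
  The carry \<open>trace m (a * x) * e0\<close> from adding the constant is linear in \<open>x\<close>, and
  is absorbed into the Reed-Muller part.
\<close>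

lemma phi_word:
  assumes "a \<in> GF2 m" "b \<in> GF2 m" "set xs \<subseteq> GF2 m"
  shows "\<phi> (map (word m a b (lift_bit e0 + twice_bit e1)) xs) =
    map2 (+) (pair_vec xs (\<lambda>x. Q m (a * x)) (\<lambda>x. Q m (a * x) + trace m (a * x)))
      (pair_vec xs (\<lambda>x. trace m ((b + to_ac e0 * a) * x) + e1)
        (\<lambda>x. trace m ((b + to_ac e0 * a) * x) + (e1 + e0)))"
proof -
  have eq: "word m a b (lift_bit e0 + twice_bit e1) x =
      lift_bit (trace m (a * x) + e0)
      + twice_bit (Q m (a * x) + (trace m ((b + to_ac e0 * a) * x) + e1))"
    if "x \<in> GF2 m" for x
  proof -
    \<comment> \<open>\<open>Z\<close> is the carry of \<open>lift_bit_add\<close> and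
      \<open>Z'\<close> the trace term brought in by \<open>to_ac e0 * a\<close>; they are equal and
      even, so they cancel.\<close>
    have alg: "A + q + b + (E + e) = A + E + Z + (q + (b + Z' + e))" if "Z' + Z = 0"
      for A q b E e Z Z' :: z4
    proof -
      have "A + E + Z + (q + (b + Z' + e)) = A + q + b + (E + e) + (Z' + Z)"
        by (simp only: add_ac)
      then show ?thesis by (simp only: that add_0_right)
    qed
    have tr: "trace m ((b + to_ac e0 * a) * x) = trace m (b * x) + e0 * trace m (a * x)"
      using that assms by (simp add: distrib_right trace_add trace_to_ac_mult mult.assoc)
    have "twice_bit (e0 * trace m (a * x)) + twice_bit (trace m (a * x) * e0) = 0"
      by (simp add: mult.commute flip: twice_bit_add)
    then show ?thesis
      unfolding word_def quad_def lift_bit_add twice_bit_add tr by (rule alg)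
  qed
  have "\<phi> (map (word m a b (lift_bit e0 + twice_bit e1)) xs)
      = pair_vec xs (\<lambda>x. \<beta> (word m a b (lift_bit e0 + twice_bit e1) x))
          (\<lambda>x. \<gamma> (word m a b (lift_bit e0 + twice_bit e1) x))"
    by (simp add: \<phi>_def pair_vec_def)
  also have "\<dots> = pair_vec xs (\<lambda>x. Q m (a * x) + (trace m ((b + to_ac e0 * a) * x) + e1))
      (\<lambda>x. Q m (a * x) + trace m (a * x) + (trace m ((b + to_ac e0 * a) * x) + (e1 + e0)))"
    using assms(3) by (auto simp: pair_vec_def eq algebra_simps)
  finally show ?thesis by (simp only: map2_pair_vec)
qed

lemma kerdock_code_eq:
  assumes xs: "set xs = GF2 m"
  shows "kerdock_code m xs = \<phi> ` quaternary_kerdock m xs"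
proof (rule Set.set_eqI, rule iffI)
  fix v assume "v \<in> kerdock_code m xs"
  then obtain a \<eta> B B' where a: "a \<in> GF2 m" "\<eta> \<in> GF2 m" and v:
    "v = map2 (+) (pair_vec xs (\<lambda>x. Q m (a * x)) (\<lambda>x. Q m (a * x) + trace m (a * x)))
      (pair_vec xs (\<lambda>x. trace m (\<eta> * x) + B) (\<lambda>x. trace m (\<eta> * x) + B'))"
    unfolding kerdock_code_def RM1_def by auto
  \<comment> \<open>Inverts the substitution in \<open>phi_word\<close>: the constants of the two
    halves are \<open>e1\<close> and \<open>e1 + e0\<close>, so \<open>e0 = B + B'\<close>, and
    adding \<open>e0 * a\<close> twice gives 0.\<close>
  define b where "b = \<eta> + to_ac (B + B') * a"
  have "b + to_ac (B + B') * a = \<eta>" unfolding b_def add.assoc ac_add_self by simp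
  moreover have "B + (B + B') = B'" by (simp flip: add.assoc)
  moreover have b: "b \<in> GF2 m" using a by (simp add: b_def del: to_ac_add)
  ultimately have "v = \<phi> (map (word m a b (lift_bit (B + B') + twice_bit B)) xs)"
    using phi_word[OF a(1) b, of xs "B + B'" B] xs unfolding v by (simp only: order_refl)
  then show "v \<in> \<phi> ` quaternary_kerdock m xs"
    unfolding phi_quaternary_kerdock using a b
    by (intro image_eqI[of _ _ "(a, b, lift_bit (B + B') + twice_bit B)"]) simp_all
next
  fix v assume "v \<in> \<phi> ` quaternary_kerdock m xs"
  then obtain a b e where ab: "a \<in> GF2 m" "b \<in> GF2 m" and v: "v = \<phi> (map (word m a b e) xs)"
    unfolding phi_quaternary_kerdock by auto
  obtain e0 e1 where "e = lift_bit e0 + twice_bit e1" using z4_decomp by blast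
  with v ab xs have "v = map2 (+) (pair_vec xs (\<lambda>x. Q m (a * x)) (\<lambda>x. Q m (a * x) + trace m (a * x)))
      (pair_vec xs (\<lambda>x. trace m ((b + to_ac e0 * a) * x) + e1)
        (\<lambda>x. trace m ((b + to_ac e0 * a) * x) + (e1 + e0)))"
    using phi_word[of a m b xs e0 e1] by simp
  moreover have "b + to_ac e0 * a \<in> GF2 m" using ab by simp
  ultimately show "v \<in> kerdock_code m xs"
    unfolding kerdock_code_def RM1_def using ab(1) by blast
qed

lemma quaternary_kerdock_permutation:
  assumes xs: "distinct xs" "set xs = GF2 m" and ys: "distinct ys" "set ys = GF2 m" and m: "m > 0"
  shows "equal_up_to_permutation (2 ^ (m + 1)) (\<phi> ` quaternary_kerdock m xs) (\<phi> ` quaternary_kerdock m ys)"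
proof -
  \<comment> \<open>Coordinates are tagged with their half and their field element, so that every
    codeword is a function of one tagged list and a single permutation serves all codewords.\<close>
  define L where "L zs = map (Pair False) zs @ map (Pair True) zs" for zs :: "bit alg_closure list"
  define G where "G f = (\<lambda>(s, x). if s then \<gamma> (f x) else \<beta> (f x))" for f :: "bit alg_closure \<Rightarrow> z4"
  have phi: "\<phi> (map f zs) = map (G f) (L zs)" for f zs
    by (simp add: \<phi>_def L_def G_def)
  have "mset xs = mset ys" using xs ys by (simp add: set_eq_iff_mset_eq_distinct[symmetric])
  then have "mset (L ys) = mset (L xs)" by (simp add: L_def)
  then obtain p where p: "p permutes {..<length (L xs)}" "permute_list p (L xs) = L ys"
    by (rule mset_eq_permutation)
  have len: "length (L xs) = 2 ^ (m + 1)"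
    using distinct_card[OF xs(1)] xs(2) card_GF2[OF m] by (simp add: L_def)
  have "permute_list p (\<phi> (map f xs)) = \<phi> (map f ys)" for f
    using p by (simp add: phi permute_list_map)
  then have "permute_list p ` (\<phi> ` quaternary_kerdock m xs) = \<phi> ` quaternary_kerdock m ys"
    unfolding phi_quaternary_kerdock image_image by (simp add: case_prod_unfold)
  with p(1) show ?thesis unfolding equal_up_to_permutation_def len by blast
qed

section \<open>Cyclic codes\<close>

lemma coeff_Poly_less: "i < length c \<Longrightarrow> coeff (Poly c) i = c ! i"
  by (simp add: nth_default_def)

lemma coeff_Poly_ge: "length c \<le> i \<Longrightarrow> coeff (Poly c) i = 0"
  by (simp add: nth_default_def)

lemma degree_Poly_less: "Poly c \<noteq> 0 \<Longrightarrow> degree (Poly c) < length c"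
  using coeff_Poly_ge[of c "degree (Poly c)"] by (metis leading_coeff_0_iff not_le)

lemma Poly_eq_imp_eq:
  assumes "Poly c = Poly c'" "length c = length c'"
  shows "c = c'"
  using assms by (metis coeff_Poly_less nth_equalityI)

lemma Poly_map_coeff:
  assumes "\<And>i. i \<ge> n \<Longrightarrow> coeff q i = 0"
  shows "Poly (map (coeff q) [0..<n]) = q"
proof (rule poly_eqI)
  show "coeff (Poly (map (coeff q) [0..<n])) i = coeff q i" for i
    using assms[of i] by (simp add: nth_default_def)
qed

lemma Poly_map2_add:
  assumes "length u = length v"
  shows "Poly (map2 (+) u v) = Poly u + Poly v"
  using assms by (intro poly_eqI) (simp add: nth_default_def)

lemma Poly_map_mult: "Poly (map ((*) a) u) = smult a (Poly u)"
  by (intro poly_eqI) (simp add: nth_default_def)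

lemma cyclic_code_eq:
  fixes g :: "'a::comm_ring_1 poly"
  assumes "g dvd monom 1 n - 1"
  shows "cyclic_code n g = {c. length c = n \<and> g dvd Poly c}"
proof -
  have "(\<exists>a. monom 1 n - 1 dvd p - a * g) \<longleftrightarrow> g dvd p" for p
  proof
    assume "\<exists>a. monom 1 n - 1 dvd p - a * g"
    then obtain a where "g dvd p - a * g" using assms dvd_trans by blast
    then have "g dvd p - a * g + a * g" by (intro dvd_add) simp_all
    then show "g dvd p" by simp
  next
    assume "g dvd p"
    then obtain a where "p = a * g" by (metis dvdE mult.commute)
    then show "\<exists>a. monom 1 n - 1 dvd p - a * g" by (intro exI[of _ a]) simp
  qed
  then show ?thesis by (simp add: cyclic_code_def)
qed

lemma linear_code_cyclic_code:
  fixes g :: "'a::comm_ring_1 poly"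
  assumes "g dvd monom 1 n - 1"
  shows "linear_code n (cyclic_code n g)"
  unfolding linear_code_def cyclic_code_eq[OF assms]
  by (auto simp: Poly_map2_add Poly_map_mult dvd_smult)

lemma sum_list_map2_add:
  fixes u v :: "'a::comm_monoid_add list"
  assumes "length u = length v"
  shows "sum_list (map2 (+) u v) = sum_list u + sum_list v"
  using assms by (induction u v rule: list_induct2) (simp_all add: add_ac)

lemma linear_code_parity_extend:
  fixes C :: "'a::comm_ring_1 list set"
  assumes "linear_code n C"
  shows "linear_code (n + 1) (parity_extend ` C)"
  unfolding linear_code_def
proof (intro conjI ballI allI)
  have len: "length c = n" if "c \<in> C" for c
    using assms that by (auto simp: linear_code_def)
  show "parity_extend ` C \<subseteq> {c. length c = n + 1}"
    by (auto simp: parity_extend_def len)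
  have "replicate (n + 1) (0 :: 'a) = parity_extend (replicate n 0)"
    by (simp add: parity_extend_def replicate_append_same sum_list_replicate)
  then show "replicate (n + 1) 0 \<in> parity_extend ` C"
    using assms by (auto simp: linear_code_def)
  show "map2 (+) u v \<in> parity_extend ` C" if uv: "u \<in> parity_extend ` C" "v \<in> parity_extend ` C" for u v
  proof -
    obtain c c' where c: "c \<in> C" "c' \<in> C" "u = parity_extend c" "v = parity_extend c'"
      using uv by blast
    then have "map2 (+) u v = parity_extend (map2 (+) c c')"
      by (simp add: parity_extend_def len sum_list_map2_add)
    then show ?thesis using assms c by (auto simp: linear_code_def)
  qed
  show "map ((*) a) u \<in> parity_extend ` C" if u: "u \<in> parity_extend ` C" for a u
  proof -
    obtain c where c: "c \<in> C" "u = parity_extend c" using u by blast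
    then have "map ((*) a) u = parity_extend (map ((*) a) c)"
      by (simp add: parity_extend_def sum_list_const_mult)
    then show ?thesis using assms c by (auto simp: linear_code_def)
  qed
qed

lemma inj_parity_extend: "inj parity_extend"
  by (rule injI) (simp add: parity_extend_def)

text \<open>The codewords are the products \<open>g * q\<close> with \<open>q\<close> of degree
  below \<open>d\<close>, uniquely so because the leading coefficient of \<open>g\<close> is a
  unit.\<close>

lemma card_multiples_code:
  fixes g :: "'a::{comm_ring_1,finite} poly"
  assumes u: "lead_coeff g * u = 1" and d: "degree g + d = n"
  shows "card {c. length c = n \<and> g dvd Poly c} = CARD('a) ^ d"
proof -
  let ?f = "\<lambda>s. map (coeff (g * Poly s)) [0..<n]"
  have Poly_f: "Poly (?f s) = g * Poly s" if s: "length s = d" for s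
  proof (rule Poly_map_coeff)
    fix i assume i: "i \<ge> n"
    show "coeff (g * Poly s) i = 0"
    proof (cases "Poly s = 0")
      case False
      then have "degree (Poly s) < d" using degree_Poly_less s by blast
      then have "degree (g * Poly s) < i"
        using degree_mult_le[of g "Poly s"] d i by linarith
      then show ?thesis by (rule coeff_eq_0)
    qed simp
  qed
  have "bij_betw ?f {s. length s = d} {c. length c = n \<and> g dvd Poly c}"
  proof (rule bij_betwI')
    fix s s' :: "'a list"
    assume s: "s \<in> {s. length s = d}" "s' \<in> {s. length s = d}"
    show "?f s = ?f s' \<longleftrightarrow> s = s'"
    proof
      assume "?f s = ?f s'"
      then have "Poly (?f s) = Poly (?f s')" by (rule arg_cong)
      then have "g * Poly s = g * Poly s'" using s by (simp only: Poly_f mem_Collect_eq)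
      then have "Poly s = Poly s'" by (rule unit_lead_coeff_mult_cancel[OF u])
      then show "s = s'" using s by (intro Poly_eq_imp_eq) simp_all
    qed simp
  next
    fix s :: "'a list"
    assume "s \<in> {s. length s = d}"
    then have "g dvd Poly (?f s)" by (simp only: Poly_f mem_Collect_eq dvd_triv_left)
    then show "?f s \<in> {c. length c = n \<and> g dvd Poly c}"
      by (simp only: mem_Collect_eq length_map length_upt minus_nat.diff_0 simp_thms)
  next
    fix c assume c: "c \<in> {c. length c = n \<and> g dvd Poly c}"
    then obtain q where q: "Poly c = g * q" by (auto elim: dvdE)
    have deg: "coeff q i = 0" if "i \<ge> d" for i
    proof (cases "q = 0")
      case False
      then have "degree (g * q) = degree g + degree q" "g * q \<noteq> 0"
        using unit_lead_coeff_degree_mult(1)[OF u] monic_mult_eq_0[OF u] by auto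
      moreover from this have "degree (g * q) < n"
        using c degree_Poly_less[of c] unfolding q by simp
      ultimately have "degree q < i" using d that by linarith
      then show ?thesis by (rule coeff_eq_0)
    qed simp
    let ?s = "map (coeff q) [0..<d]"
    have "Poly ?s = q" using deg by (rule Poly_map_coeff)
    then have "Poly (?f ?s) = Poly c" using Poly_f[of ?s] q by (simp only: length_map length_upt minus_nat.diff_0)
    then have "?f ?s = c" by (rule Poly_eq_imp_eq) (use c in simp)
    then show "\<exists>s \<in> {s. length s = d}. c = ?f s"
      by (intro bexI[of _ ?s]) (simp_all only: length_map length_upt minus_nat.diff_0 mem_Collect_eq)
  qed
  then have "card {c. length c = n \<and> g dvd Poly c} = card {s :: 'a list. length s = d}"
    by (simp add: bij_betw_same_card)
  also have "\<dots> = CARD('a) ^ d"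
    using card_lists_length_eq[of "UNIV :: 'a set" d] by simp
  finally show ?thesis .
qed


section \<open>The shift action of polynomials on sequences\<close>

text \<open>Sequences form a module over the polynomial ring with \<open>X\<close> acting as the
  left shift; being annihilated by \<open>p\<close> is the linear recurrence with characteristic
  polynomial \<open>p\<close>.\<close>

definition shift_act :: "'a::comm_ring_1 poly \<Rightarrow> (nat \<Rightarrow> 'a) \<Rightarrow> nat \<Rightarrow> 'a" where
  "shift_act p w t = (\<Sum>i\<le>degree p. coeff p i * w (t + i))"

lemma shift_act_altdef:
  assumes "degree p \<le> d"
  shows "shift_act p w t = (\<Sum>i\<le>d. coeff p i * w (t + i))"
  unfolding shift_act_def
  by (rule sum.mono_neutral_left) (use assms in \<open>auto simp: coeff_eq_0\<close>)

lemma shift_act_0 [simp]: "shift_act 0 w t = 0"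
  by (simp add: shift_act_def)

lemma shift_act_pCons: "shift_act (pCons a p) w t = a * w t + shift_act p w (Suc t)"
proof -
  have "shift_act (pCons a p) w t = (\<Sum>i\<le>Suc (degree p). coeff (pCons a p) i * w (t + i))"
    by (rule shift_act_altdef) (rule degree_pCons_le)
  then show ?thesis unfolding sum.atMost_Suc_shift by (simp add: shift_act_def)
qed

lemma shift_act_add: "shift_act (p + q) w t = shift_act p w t + shift_act q w t"
proof -
  define d where "d = max (degree p) (degree q)"
  have "degree (p + q) \<le> d" "degree p \<le> d" "degree q \<le> d"
    by (simp_all add: d_def degree_add_le)
  then show ?thesis by (simp add: shift_act_altdef[of _ d] distrib_right sum.distrib)
qed

lemma shift_act_smult: "shift_act (smult c p) w t = c * shift_act p w t"
  unfolding shift_act_altdef[of "smult c p" "degree p" w t, OF degree_smult_le]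
  by (simp add: shift_act_def sum_distrib_left mult.assoc)

lemma shift_act_mult: "shift_act (p * q) w t = shift_act p (shift_act q w) t"
  by (induction p arbitrary: t) (simp_all add: shift_act_pCons shift_act_add shift_act_smult)

lemma shift_act_diff: "shift_act (p - q) w t = shift_act p w t - shift_act q w t"
  using shift_act_add[of "p - q" q w t] by simp

lemma shift_act_monom: "shift_act (monom c k) w t = c * w (t + k)"
proof -
  have "shift_act (monom c k) w t = (\<Sum>i\<le>k. coeff (monom c k) i * w (t + i))"
    by (rule shift_act_altdef) (rule degree_monom_le)
  also have "\<dots> = (\<Sum>i\<le>k. if i = k then c * w (t + k) else 0)"
    by (intro sum.cong) auto
  finally show ?thesis by simp
qed

lemma shift_act_1: "shift_act 1 w t = w t"
  by (simp add: shift_act_def)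

lemma shift_act_zero_seq: "(\<And>t. w t = 0) \<Longrightarrow> shift_act p w t = 0"
  by (simp add: shift_act_def)

lemma sum_periodic_shift:
  fixes w :: "nat \<Rightarrow> 'a::ab_group_add"
  assumes "\<And>t. w (t + n) = w t"
  shows "(\<Sum>t<n. w (t + i)) = (\<Sum>t<n. w t)"
proof (induction i)
  case (Suc i)
  have "(\<Sum>t<n. w (Suc t + i)) + w (0 + i) = (\<Sum>t<n. w (t + i)) + w (n + i)"
    using sum.lessThan_Suc_shift[of "\<lambda>t. w (t + i)" n] sum.lessThan_Suc[of "\<lambda>t. w (t + i)" n]
    by (simp add: add.commute)
  moreover have "w (n + i) = w (0 + i)" using assms[of i] by (simp add: add.commute)
  ultimately show ?case using Suc by simp
qed simp

text \<open>A shift does not change the sum over a period, so \<open>X\<close> acts on that sum as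
  1. This will determine the parity check.\<close>

lemma sum_shift_act:
  assumes "\<And>t. w (t + n) = w t"
  shows "(\<Sum>t<n. shift_act p w t) = poly p 1 * (\<Sum>t<n. w t)"
proof -
  have "(\<Sum>t<n. shift_act p w t) = (\<Sum>i\<le>degree p. \<Sum>t<n. coeff p i * w (t + i))"
    unfolding shift_act_def by (rule sum.swap)
  also have "\<dots> = (\<Sum>i\<le>degree p. coeff p i * (\<Sum>t<n. w t))"
    by (simp add: sum_periodic_shift[of w n, OF assms] flip: sum_distrib_left)
  finally show ?thesis by (simp add: poly_altdef sum_distrib_right)
qed

section \<open>Words annihilated by a polynomial\<close>

text \<open>Reversal relative to a formal degree \<open>d\<close>, which stays multiplicative when
  zero divisors make the actual degree drop.\<close>

definition rev_poly :: "nat \<Rightarrow> 'a::comm_ring_1 poly \<Rightarrow> 'a poly" where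
  "rev_poly d p = (\<Sum>i\<le>d. monom (coeff p i) (d - i))"

lemma coeff_rev_poly: "coeff (rev_poly d p) j = (if j \<le> d then coeff p (d - j) else 0)"
proof -
  have "coeff (rev_poly d p) j = (\<Sum>i\<le>d. if i = d - j \<and> j \<le> d then coeff p (d - j) else 0)"
    unfolding rev_poly_def coeff_sum coeff_monom by (intro sum.cong) auto
  then show ?thesis by simp
qed

lemma reflect_poly_eq_rev_poly: "reflect_poly p = rev_poly (degree p) p"
  by (rule poly_eqI) (simp add: coeff_reflect_poly coeff_rev_poly)

lemma rev_poly_mult:
  assumes "degree p \<le> d" "degree q \<le> e"
  shows "rev_poly (d + e) (p * q) = rev_poly d p * rev_poly e q"
  using assms(1)
proof (induction p arbitrary: d)
  case 0
  then show ?case by (simp add: rev_poly_def)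
next
  case (pCons a p)
  \<comment> \<open>An excess \<open>k\<close> of the formal degree becomes a factor
    \<open>X^k\<close> after reversal.\<close>
  have pad: "rev_poly (k + e) (smult a q) = monom a k * rev_poly e q" for k
    using assms(2)
    by (intro poly_eqI) (auto simp: coeff_rev_poly coeff_monom_mult coeff_eq_0 add.commute)
  show ?case
  proof (cases "p = 0")
    case True
    have "rev_poly d [:a:] = monom a d"
      by (intro poly_eqI) (auto simp: coeff_rev_poly coeff_pCons split: nat.split)
    then show ?thesis using True pad[of d] by simp
  next
    case False
    then obtain d' where d': "d = Suc d'" "degree p \<le> d'"
      using pCons.prems by (cases d) auto
    have "rev_poly (Suc d') (pCons a p) = monom a (Suc d') + rev_poly d' p"
      using d' by (intro poly_eqI) (auto simp: coeff_rev_poly coeff_pCons Suc_diff_le split: nat.split)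
    moreover have "rev_poly (Suc d' + e) (smult a q + pCons 0 (p * q))
        = rev_poly (Suc d' + e) (smult a q) + rev_poly (d' + e) (p * q)"
      by (intro poly_eqI) (auto simp: coeff_rev_poly coeff_pCons Suc_diff_le split: nat.split)
    ultimately show ?thesis
      using pad[of "Suc d'"] pCons.IH[OF d'(2)] d' by (simp add: distrib_right)
  qed
qed

definition period_poly :: "nat \<Rightarrow> (nat \<Rightarrow> 'a::comm_ring_1) \<Rightarrow> 'a poly" where
  "period_poly n w = (\<Sum>t<n. monom (w t) t)"

lemma Poly_map_eq_period_poly: "Poly (map w [0..<n]) = period_poly n w"
proof (rule poly_eqI)
  fix i
  have "coeff (period_poly n w) i = (\<Sum>t<n. if t = i then w i else 0)"
    unfolding period_poly_def coeff_sum coeff_monom by (intro sum.cong) auto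
  then show "coeff (Poly (map w [0..<n])) i = coeff (period_poly n w) i"
    by (simp add: nth_default_def)
qed

lemma smult_sum_right: "smult a (sum f A) = (\<Sum>i\<in>A. smult a (f i))"
  by (induction A rule: infinite_finite_induct) (simp_all add: smult_add_right)

text \<open>Modulo \<open>X^n - 1\<close> the left shift is multiplication by the inverse of
  \<open>X\<close>.\<close>

lemma period_poly_shift:
  assumes per: "\<And>t. w (t + n) = w t"
  shows "monom 1 n - 1 dvd period_poly n w - monom 1 i * period_poly n (\<lambda>t. w (t + i))"
proof (induction i)
  case 0
  then show ?case by simp
next
  case (Suc i)
  let ?w = "\<lambda>t. w (t + i)"
  have "monom 1 1 * period_poly n (\<lambda>t. ?w (Suc t)) = (\<Sum>t<n. monom (?w (Suc t)) (Suc t))"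
    by (simp add: period_poly_def sum_distrib_left mult_monom)
  \<comment> \<open>Shifting trades the term of exponent 0 for one of exponent \<open>n\<close>; by
    periodicity their coefficients agree.\<close>
  also have "\<dots> = period_poly n ?w + monom (?w n) n - monom (?w 0) 0"
    using sum.lessThan_Suc_shift[of "\<lambda>t. monom (?w t) t" n] sum.lessThan_Suc[of "\<lambda>t. monom (?w t) t" n]
    by (simp add: period_poly_def algebra_simps)
  also have "\<dots> = period_poly n ?w + monom (w i) 0 * (monom 1 n - 1)"
    using per[of i] by (simp add: algebra_simps mult_monom)
  finally have step: "monom 1 1 * period_poly n (\<lambda>t. ?w (Suc t))
      = period_poly n ?w + monom (w i) 0 * (monom 1 n - 1)" .
  have "monom (1::'a) (Suc i) = monom 1 i * monom 1 1" by (simp add: mult_monom)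
  then have "period_poly n w - monom 1 (Suc i) * period_poly n (\<lambda>t. ?w (Suc t))
      = period_poly n w - monom 1 i * (period_poly n ?w + monom (w i) 0 * (monom 1 n - 1))"
    by (simp only: step mult.assoc)
  also have "\<dots> = (period_poly n w - monom 1 i * period_poly n ?w)
      - monom 1 i * monom (w i) 0 * (monom 1 n - 1)"
    by (simp only: algebra_simps)
  finally have eq: "period_poly n w - monom 1 (Suc i) * period_poly n (\<lambda>t. ?w (Suc t))
      = (period_poly n w - monom 1 i * period_poly n ?w)
      - monom 1 i * monom (w i) 0 * (monom 1 n - 1)" .
  have "(\<lambda>t. w (t + Suc i)) = (\<lambda>t. ?w (Suc t))" by simp
  then show ?case unfolding eq by (simp only: eq) (intro dvd_diff Suc.IH dvd_triv_right)
qed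

text \<open>As the shift inverts \<open>X\<close>, the action of \<open>p\<close> is multiplication
  by p(1/X), that is, by its reversal up to a power of \<open>X\<close>. This is why the generator
  is a reciprocal polynomial.\<close>

lemma rev_poly_mult_period_poly:
  assumes per: "\<And>t. w (t + n) = w t" and d: "degree p \<le> d"
  shows "monom 1 n - 1 dvd rev_poly d p * period_poly n w - monom 1 d * period_poly n (shift_act p w)"
proof -
  have "period_poly n (shift_act p w) = (\<Sum>t<n. \<Sum>i\<le>d. smult (coeff p i) (monom (w (t + i)) t))"
    unfolding period_poly_def by (simp add: shift_act_altdef[OF d] smult_monom flip: monom_sum)
  also have "\<dots> = (\<Sum>i\<le>d. smult (coeff p i) (period_poly n (\<lambda>t. w (t + i))))"
    unfolding period_poly_def smult_sum_right by (rule sum.swap)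
  finally have "monom 1 d * period_poly n (shift_act p w)
      = (\<Sum>i\<le>d. monom 1 d * smult (coeff p i) (period_poly n (\<lambda>t. w (t + i))))"
    by (simp only: sum_distrib_left)
  also have "\<dots> = (\<Sum>i\<le>d. monom (coeff p i) (d - i) * (monom 1 i * period_poly n (\<lambda>t. w (t + i))))"
  proof (intro sum.cong refl)
    fix i assume "i \<in> {..d}"
    then have "monom (coeff p i) (d - i) * monom 1 i = smult (coeff p i) (monom 1 d)"
      by (simp add: mult_monom smult_monom)
    then show "monom 1 d * smult (coeff p i) (period_poly n (\<lambda>t. w (t + i)))
        = monom (coeff p i) (d - i) * (monom 1 i * period_poly n (\<lambda>t. w (t + i)))"
      by (simp flip: mult.assoc)
  qed
  finally have "rev_poly d p * period_poly n w - monom 1 d * period_poly n (shift_act p w)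
      = (\<Sum>i\<le>d. monom (coeff p i) (d - i)
          * (period_poly n w - monom 1 i * period_poly n (\<lambda>t. w (t + i))))"
    unfolding rev_poly_def sum_distrib_right by (simp only: right_diff_distrib sum_subtractf)
  also have "monom 1 n - 1 dvd \<dots>"
    by (intro dvd_sum dvd_mult period_poly_shift per)
  finally show ?thesis .
qed

text \<open>Reversal turns \<open>P * k\<close> into a factorization of \<open>1 - X^n\<close>. If
  \<open>P\<close> annihilates \<open>w\<close>, then \<open>X^n - 1\<close> divides the reversed
  \<open>P\<close> times the word of \<open>w\<close>; cancelling the reversed \<open>P\<close>
  leaves a multiple of the reversed \<open>k\<close>.\<close>

lemma reflect_cofactor:
  fixes P k :: "'a::comm_ring_1 poly"
  assumes n: "n > 0" and eq: "monom 1 n - 1 = P * k" and P: "lead_coeff P = 1"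
    and nontriv: "(1::'a) \<noteq> 0"
  shows "degree (reflect_poly k) + degree P = n"
    and "\<exists>u. lead_coeff (reflect_poly k) * u = 1"
    and "reflect_poly k dvd monom 1 n - 1"
    and "\<And>w. (\<And>t. w (t + n) = w t) \<Longrightarrow> (\<And>t. shift_act P w t = 0)
      \<Longrightarrow> reflect_poly k dvd Poly (map w [0..<n])"
proof -
  \<comment> \<open>Both constant terms are units; hence reversal preserves the degrees and yields
    unit leading coefficients.\<close>
  have "coeff (P * k) 0 = - 1" using n by (simp flip: eq)
  then have u: "coeff P 0 * - coeff k 0 = 1" by (simp add: coeff_mult)
  then have k0: "coeff k 0 \<noteq> 0" and P0: "coeff P 0 \<noteq> 0" using nontriv by auto
  then have k: "k \<noteq> 0" by auto
  have "degree (monom (1::'a) n - 1) = n"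
    unfolding diff_conv_add_uminus using n
    by (subst degree_add_eq_left) (simp_all add: degree_monom_eq nontriv)
  then have deg: "degree P + degree k = n"
    using unit_lead_coeff_degree_mult(1)[of P 1 k] P k by (simp add: eq)
  then show "degree (reflect_poly k) + degree P = n" using k0 by simp
  show "\<exists>v. lead_coeff (reflect_poly k) * v = 1"
    using u k0 by (intro exI[of _ "- coeff P 0"]) (simp add: coeff_reflect_poly mult.commute)
  have "rev_poly (degree P + degree k) (P * k) = rev_poly (degree P) P * rev_poly (degree k) k"
    by (rule rev_poly_mult) simp_all
  then have "reflect_poly P * reflect_poly k = rev_poly n (monom 1 n - 1)"
    by (simp only: reflect_poly_eq_rev_poly deg eq)
  also have "\<dots> = - (monom 1 n - 1)"
    by (intro poly_eqI) (use n in \<open>auto simp: coeff_rev_poly coeff_1\<close>)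
  finally have refl: "reflect_poly P * reflect_poly k = - (monom 1 n - 1)" .
  then show dvd: "reflect_poly k dvd monom 1 n - 1" by (metis dvd_minus_iff dvd_triv_right)
  fix w :: "nat \<Rightarrow> 'a"
  assume w: "\<And>t. w (t + n) = w t" "\<And>t. shift_act P w t = 0"
  have "period_poly n (shift_act P w) = 0" using w(2) by (simp add: period_poly_def)
  then have "monom 1 n - 1 dvd reflect_poly P * period_poly n w"
    using rev_poly_mult_period_poly[of w n P "degree P", OF w(1)]
    by (simp add: reflect_poly_eq_rev_poly)
  then obtain s where "reflect_poly P * period_poly n w = (monom 1 n - 1) * s" ..
  also have "\<dots> = reflect_poly P * (reflect_poly k * - s)"
    by (simp only: mult.assoc[symmetric] refl minus_mult_minus)
  finally have cancel: "reflect_poly P * period_poly n w = reflect_poly P * (reflect_poly k * - s)" .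
  have "lead_coeff (reflect_poly P) * - coeff k 0 = 1"
    using u P0 by (simp add: coeff_reflect_poly)
  from this cancel have "period_poly n w = reflect_poly k * - s"
    by (rule unit_lead_coeff_mult_cancel)
  then show "reflect_poly k dvd Poly (map w [0..<n])"
    unfolding Poly_map_eq_period_poly by (metis dvd_triv_left)
qed


section \<open>Kerdock words as linear recurring sequences\<close>

abbreviation eval_ac :: "bit poly \<Rightarrow> bit alg_closure \<Rightarrow> bit alg_closure" where
  "eval_ac p x \<equiv> poly (map_poly to_ac p) x"

lemma map_poly_to_ac_mult: "map_poly to_ac (p * q) = map_poly to_ac p * map_poly to_ac q"
  for p q :: "bit poly"
  by (rule poly_eqI) (simp add: coeff_map_poly coeff_mult to_ac_sum)

lemma map_poly_to_ac_add: "map_poly to_ac (p + q) = map_poly to_ac p + map_poly to_ac q"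
  for p q :: "bit poly"
  by (rule poly_eqI) (simp add: coeff_map_poly)

lemma map_poly_to_ac_monom_diff_1: "map_poly to_ac (monom 1 n - 1 :: bit poly) = monom 1 n - 1"
proof -
  have "map_poly to_ac (monom 1 n - 1 :: bit poly) = map_poly to_ac (monom 1 n) - map_poly to_ac 1"
    by (rule poly_eqI) (simp add: coeff_map_poly del: minus_bit_def)
  then show ?thesis by (simp add: map_poly_monom map_poly_1')
qed

lemma eval_ac_pCons: "eval_ac (pCons a p) x = to_ac a + x * eval_ac p x"
  by (simp add: map_poly_pCons)

lemma eval_ac_in_GF2:
  assumes "x \<in> GF2 m"
  shows "eval_ac p x \<in> GF2 m"
  using assms by (induction p) (simp_all add: eval_ac_pCons)

lemma red_poly_monom_diff_1: "red_poly (monom 1 n - 1) = monom 1 n - 1"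
  by (simp add: red_poly_diff red_poly_monom)

text \<open>An even factor destroys the quadratic part, so \<open>a\<close> sees only the reduction
  of \<open>c\<close>.\<close>

lemma word_scalar:
  assumes ab: "a \<in> GF2 m" "b \<in> GF2 m" and m: "odd m"
  shows "\<exists>b' \<in> GF2 m. \<forall>x \<in> GF2 m. c * word m a b 0 x = word m (to_ac (red2 c) * a) b' 0 x"
proof -
  have zero: "word m 0 0 0 x = 0" for x by (simp add: word_def)
  consider "c = 0" | "c = 1" | "c = 2" | "c = 3" using z4_cases by blast
  then show ?thesis
  proof cases
    case 1
    then show ?thesis using zero by (intro bexI[of _ 0]) simp_all
  next
    case 2
    then show ?thesis using ab by (intro bexI[of _ b]) simp_all
  next
    case 3
    obtain b' where b': "b' \<in> GF2 m"
      "\<And>x. x \<in> GF2 m \<Longrightarrow> word m a b 0 x + word m a b 0 x = word m (a + a) b' (0 + 0) x"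
      using word_add[OF ab ab m] by blast
    have "red2 c = 0" using 3 by (simp add: red2_def)
    with b' 3 show ?thesis by (intro bexI[of _ b']) (simp_all flip: mult_2)
  next
    case 4
    obtain b' where b': "b' \<in> GF2 m"
      "\<And>x. x \<in> GF2 m \<Longrightarrow> word m 0 0 0 x - word m a b 0 x = word m (0 + a) b' (0 - 0) x"
      using word_diff[of 0 m 0 a b 0 0] ab m by auto
    have "red2 c = 1" "c = - 1" using 4 by (simp_all add: red2_def)
    with b' zero show ?thesis by (intro bexI[of _ b']) simp_all
  qed
qed

lemma word_shift: "word m a b 0 (\<alpha> ^ Suc t) = word m (a * \<alpha>) (b * \<alpha>) 0 (\<alpha> ^ t)"
  by (simp add: word_def mult.assoc)

text \<open>A shift multiplies \<open>a\<close> by \<alpha> and sums of words add their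
  \<open>a\<close>, so a polynomial acts on \<open>a\<close> through its reduction evaluated at
  \<alpha>. The linear part absorbs all carries and is left unspecified.\<close>

lemma shift_act_word:
  assumes \<alpha>: "\<alpha> \<in> GF2 m" and ab: "a \<in> GF2 m" "b \<in> GF2 m" and m: "odd m"
  shows "\<exists>b' \<in> GF2 m. \<forall>t. shift_act p (\<lambda>t. word m a b 0 (\<alpha> ^ t)) t
    = word m (a * eval_ac (red_poly p) \<alpha>) b' 0 (\<alpha> ^ t)"
proof (induction p)
  case 0
  show ?case by (intro bexI[of _ 0]) (simp_all add: word_def)
next
  case (pCons c p)
  let ?e = "eval_ac (red_poly p) \<alpha>"
  have e: "?e \<in> GF2 m" using \<alpha> by (rule eval_ac_in_GF2)
  obtain b1 where b1: "b1 \<in> GF2 m"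
    "\<And>t. shift_act p (\<lambda>t. word m a b 0 (\<alpha> ^ t)) t = word m (a * ?e) b1 0 (\<alpha> ^ t)"
    using pCons.IH by blast
  obtain b2 where b2: "b2 \<in> GF2 m"
    "\<And>x. x \<in> GF2 m \<Longrightarrow> c * word m a b 0 x = word m (to_ac (red2 c) * a) b2 0 x"
    using word_scalar[OF ab m, of c] by blast
  have in_F: "to_ac (red2 c) * a \<in> GF2 m" "a * ?e * \<alpha> \<in> GF2 m" "b1 * \<alpha> \<in> GF2 m"
    using ab \<alpha> e b1 by simp_all
  obtain b3 where b3: "b3 \<in> GF2 m" "\<And>x. x \<in> GF2 m \<Longrightarrow>
    word m (to_ac (red2 c) * a) b2 0 x + word m (a * ?e * \<alpha>) (b1 * \<alpha>) 0 x
      = word m (to_ac (red2 c) * a + a * ?e * \<alpha>) b3 (0 + 0) x"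
    using word_add[OF in_F(1) b2(1) in_F(2,3) m] by blast
  have "shift_act (pCons c p) (\<lambda>t. word m a b 0 (\<alpha> ^ t)) t
      = word m (a * eval_ac (red_poly (pCons c p)) \<alpha>) b3 0 (\<alpha> ^ t)" for t
  proof -
    have t: "\<alpha> ^ t \<in> GF2 m" using \<alpha> by simp
    have "shift_act (pCons c p) (\<lambda>t. word m a b 0 (\<alpha> ^ t)) t
        = word m (to_ac (red2 c) * a) b2 0 (\<alpha> ^ t) + word m (a * ?e) b1 0 (\<alpha> ^ Suc t)"
      by (simp only: shift_act_pCons b2(2)[OF t] b1(2))
    also have "\<dots> = word m (to_ac (red2 c) * a + a * ?e * \<alpha>) b3 0 (\<alpha> ^ t)"
      using b3(2)[OF t] by (simp only: word_shift add_0_right)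
    also have "to_ac (red2 c) * a + a * ?e * \<alpha> = a * eval_ac (red_poly (pCons c p)) \<alpha>"
      by (simp add: map_poly_pCons eval_ac_pCons algebra_simps)
    finally show ?thesis .
  qed
  with b3(1) show ?case by blast
qed

text \<open>On even words there are no carries, and the action on \<open>b\<close> is known
  exactly.\<close>

lemma shift_act_word_even:
  assumes \<alpha>: "\<alpha> \<in> GF2 m" and b: "b \<in> GF2 m"
  shows "shift_act p (\<lambda>t. word m 0 b 0 (\<alpha> ^ t)) t = word m 0 (b * eval_ac (red_poly p) \<alpha>) 0 (\<alpha> ^ t)"
proof (induction p arbitrary: t)
  case 0
  show ?case by (simp add: word_def)
next
  case (pCons c p)
  let ?e = "eval_ac (red_poly p) \<alpha>"
  have e: "?e \<in> GF2 m" using \<alpha> by (rule eval_ac_in_GF2)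
  have "b * eval_ac (red_poly (pCons c p)) \<alpha> * \<alpha> ^ t
      = to_ac (red2 c) * (b * \<alpha> ^ t) + b * ?e * \<alpha> ^ Suc t"
    by (simp add: map_poly_pCons eval_ac_pCons algebra_simps)
  then have "trace m (b * eval_ac (red_poly (pCons c p)) \<alpha> * \<alpha> ^ t)
      = red2 c * trace m (b * \<alpha> ^ t) + trace m (b * ?e * \<alpha> ^ Suc t)"
    using \<alpha> b e by (simp add: trace_add trace_to_ac_mult del: power_Suc)
  moreover have "shift_act (pCons c p) (\<lambda>t. word m 0 b 0 (\<alpha> ^ t)) t
      = c * word m 0 b 0 (\<alpha> ^ t) + word m 0 (b * ?e) 0 (\<alpha> ^ Suc t)"
    by (simp only: shift_act_pCons pCons.IH)
  ultimately show ?case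
    by (simp add: word_def mult_twice_bit twice_bit_add del: power_Suc)
qed

text \<open>For odd \<open>n\<close> the derivative of \<open>X^n - 1\<close> does not vanish at
  \<alpha>, so \<alpha> is a simple root.\<close>

lemma eval_ac_cofactor_nonzero:
  assumes n: "odd n" and \<alpha>: "\<alpha> ^ n = 1" and eq: "monom 1 n - 1 = h2 * k2"
    and root: "eval_ac h2 \<alpha> = 0"
  shows "eval_ac k2 \<alpha> \<noteq> 0"
proof
  assume k2: "eval_ac k2 \<alpha> = 0"
  have "poly (pderiv (monom 1 n - 1)) \<alpha> = poly (pderiv (map_poly to_ac h2 * map_poly to_ac k2)) \<alpha>"
    by (simp only: eq flip: map_poly_to_ac_monom_diff_1 map_poly_to_ac_mult)
  also have "\<dots> = 0" by (simp add: pderiv_mult root k2)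
  finally have "of_nat n * \<alpha> ^ (n - 1) = 0"
    by (simp add: pderiv_diff pderiv_monom poly_monom)
  moreover have "of_nat n \<noteq> (0 :: bit alg_closure)"
    using n of_nat_eq_0_iff_char_dvd[where 'a = "bit alg_closure", of n] by simp
  moreover have "\<alpha> \<noteq> 0" using \<alpha> n by (cases "n = 0") (auto simp: power_0_left)
  ultimately show False by simp
qed

text \<open>
  \<open>h\<close> maps every word into the even words, on which it acts as zero and the
  cofactor of \<open>h\<close> in \<open>X\<^sup>n - 1\<close> acts injectively.
\<close>

lemma shift_act_word_eq_0:
  assumes m: "odd m" and n: "odd n" and \<alpha>: "\<alpha> \<in> GF2 m" "\<alpha> ^ n = 1"
    and prim: "\<And>x. x \<in> GF2 m \<Longrightarrow> x \<noteq> 0 \<Longrightarrow> \<exists>t. x = \<alpha> ^ t"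
    and ab: "a \<in> GF2 m" "b \<in> GF2 m"
    and eq: "monom 1 n - 1 = h * k" and root: "eval_ac (red_poly h) \<alpha> = 0"
  shows "shift_act h (\<lambda>t. word m a b 0 (\<alpha> ^ t)) t = 0"
proof -
  let ?w = "\<lambda>t. word m a b 0 (\<alpha> ^ t)" and ?k = "eval_ac (red_poly k) \<alpha>"
  obtain b' where b': "b' \<in> GF2 m" "\<And>t. shift_act h ?w t = word m 0 b' 0 (\<alpha> ^ t)"
    using shift_act_word[OF \<alpha>(1) ab m, of h] root by auto
  have k: "?k \<in> GF2 m" "?k \<noteq> 0"
  proof -
    have "monom 1 n - 1 = red_poly h * red_poly k"
      by (simp only: eq flip: red_poly_monom_diff_1 red_poly_mult)
    then show "?k \<noteq> 0" using n \<alpha>(2) root by (intro eval_ac_cofactor_nonzero)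
  qed (rule eval_ac_in_GF2[OF \<alpha>(1)])
  \<comment> \<open>Acting by \<open>k\<close> after \<open>h\<close> is acting by
    \<open>X^n - 1\<close>, which kills every sequence of period \<open>n\<close>.\<close>
  have "word m 0 (b' * ?k) 0 (\<alpha> ^ t) = 0" for t
  proof -
    have "word m 0 (b' * ?k) 0 (\<alpha> ^ t) = shift_act k (\<lambda>t. word m 0 b' 0 (\<alpha> ^ t)) t"
      using \<alpha> b' by (simp only: shift_act_word_even)
    also have "\<dots> = shift_act k (shift_act h ?w) t"
      by (simp only: b'(2)[symmetric])
    also have "\<dots> = shift_act (monom 1 n - 1) ?w t"
      by (simp only: eq mult.commute[of h] shift_act_mult)
    also have "\<dots> = 0"
      by (simp add: shift_act_diff shift_act_monom shift_act_1 power_add \<alpha>(2))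
    finally show ?thesis .
  qed
  then have tr: "trace m (b' * ?k * \<alpha> ^ t) = 0" for t
    by (simp add: word_def)
  \<comment> \<open>The powers of \<alpha> exhaust the nonzero elements, so the nondegeneracy of the
    trace form applies.\<close>
  have "b' * ?k = 0"
  proof (rule ccontr)
    assume "b' * ?k \<noteq> 0"
    then obtain x where x: "x \<in> GF2 m" "trace m (b' * ?k * x) = 1"
      using trace_nondegenerate[of m "b' * ?k"] b' k m by (auto simp: odd_pos)
    then have "x \<noteq> 0" by auto
    with prim x obtain t where "x = \<alpha> ^ t" by blast
    with x tr show False by simp
  qed
  then show ?thesis using b' k by (simp add: word_def)
qed

section \<open>The quaternary cyclic code\<close>

lemma eval_ac_0_imp_dvd:
  assumes "irreducible h2" "eval_ac h2 \<alpha> = 0" "eval_ac p \<alpha> = 0"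
  shows "h2 dvd p"
proof (rule ccontr)
  assume "\<not> h2 dvd p"
  then obtain u v where "u * h2 + v * p = 1"
    using bezout_irreducible[OF assms(1)] by blast
  then have "eval_ac (u * h2 + v * p) \<alpha> = eval_ac 1 \<alpha>" by simp
  then show False using assms by (simp add: map_poly_to_ac_add map_poly_to_ac_mult map_poly_1')
qed

text \<open>A root at 1 would split off a linear factor. Modulo 2 this says that \<open>h\<close>
  has the value 1 there.\<close>

lemma irreducible_poly_1_nonzero:
  fixes h2 :: "'a::field poly"
  assumes irr: "irreducible h2" and deg: "degree h2 \<ge> 2"
  shows "poly h2 1 \<noteq> 0"
proof
  assume "poly h2 1 = 0"
  then have "[:-1, 1:] dvd h2" by (simp add: poly_eq_0_iff_dvd)
  then obtain q where q: "h2 = [:-1, 1:] * q" ..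
  have "\<not> is_unit ([:-1, 1:] :: 'a poly)" by (simp add: is_unit_iff_degree)
  then have "is_unit q" using irreducibleD[OF irr q] by blast
  moreover have "q \<noteq> 0" using q irr by auto
  ultimately have "degree q = 0" by (simp add: is_unit_iff_degree)
  then have "degree h2 = 1" unfolding q using \<open>q \<noteq> 0\<close> by (subst degree_mult_eq) simp_all
  with deg show False by simp
qed

lemma of_nat_pow2_minus_1:
  assumes "m \<ge> 2"
  shows "of_nat (2 ^ m - 1) = (- 1 :: z4)"
proof -
  obtain k where "m = 2 + k" using assms le_Suc_ex by blast
  then have "of_nat (2 ^ m) = (4 :: z4) * 2 ^ k" by (simp add: power_add)
  moreover have "(4 :: z4) = 0" by simp
  ultimately have "of_nat (2 ^ m) = (0 :: z4)" by (simp only: mult_zero_left)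
  then show ?thesis by (simp add: of_nat_diff)
qed

section \<open>The setting of a fixed primitive element\<close>

locale primitive_root =
  fixes m n :: nat and \<alpha> :: "bit alg_closure"
  assumes m2: "m \<ge> 2" and n_def: "n = 2 ^ m - 1" and range: "range (\<lambda>k::nat. \<alpha> ^ k) = GF2 m - {0}"
begin

lemma alpha_GF2: "\<alpha> \<in> GF2 m" and alpha_nz: "\<alpha> \<noteq> 0"
  using range rangeI[of "\<lambda>k::nat. \<alpha> ^ k" 1] by auto

lemma Suc_n: "Suc n = 2 ^ m"
  by (simp add: n_def)

lemma odd_n: "odd n"
proof -
  have "even (Suc n)" unfolding Suc_n using m2 by simp
  then show ?thesis by simp
qed

lemma alpha_pow_n: "\<alpha> ^ n = 1"
proof -
  have "\<alpha> * \<alpha> ^ n = \<alpha> * 1"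
    using alpha_GF2 by (simp add: GF2_iff Suc_n flip: power_Suc)
  then show ?thesis using alpha_nz by simp
qed

lemma powers_image: "(\<lambda>k. \<alpha> ^ k) ` {..<n} = GF2 m - {0}"
proof -
  have "\<alpha> ^ k \<in> (\<lambda>k. \<alpha> ^ k) ` {..<n}" for k
  proof (rule image_eqI)
    have "\<alpha> ^ k = \<alpha> ^ (n * (k div n) + k mod n)" by simp
    then show "\<alpha> ^ k = \<alpha> ^ (k mod n)" by (simp only: power_add power_mult alpha_pow_n) simp
    show "k mod n \<in> {..<n}" using odd_n by (simp add: odd_pos)
  qed
  then show ?thesis unfolding range[symmetric] by auto
qed

definition coords :: "bit alg_closure list" where
  "coords = map (\<lambda>k. \<alpha> ^ k) [0..<n] @ [0]"

lemma set_coords: "set coords = GF2 m"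
  using powers_image by (auto simp: coords_def atLeast0LessThan)

lemma distinct_coords: "distinct coords"
proof -
  have "card (set coords) = length coords"
    using m2 by (simp add: set_coords card_GF2 flip: Suc_n) (simp add: coords_def)
  then show ?thesis by (rule card_distinct)
qed

lemma lift_exists_unique:
  assumes irr: "irreducible h2" and deg: "degree h2 = m" and root: "eval_ac h2 \<alpha> = 0"
  shows "\<exists>!f :: z4 poly.
    lead_coeff f = 1 \<and> degree f = m \<and> red_poly f = h2 \<and> f dvd monom 1 n - 1"
proof -
  have "eval_ac (monom 1 n - 1) \<alpha> = 0"
    by (simp add: map_poly_to_ac_monom_diff_1 poly_monom alpha_pow_n)
  then have "h2 dvd monom 1 n - 1" using eval_ac_0_imp_dvd[OF irr root] by blast
  then obtain k2 where k2: "monom 1 n - 1 = h2 * k2" ..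
  \<comment> \<open>\<alpha> is a simple root of \<open>X^n - 1\<close>, hence not a root of the
    cofactor of \<open>h2\<close>.\<close>
  have ndvd: "\<not> h2 dvd k" if "monom 1 n - 1 = h2 * k" for k
  proof
    assume "h2 dvd k"
    then obtain q where "k = h2 * q" ..
    then have "eval_ac k \<alpha> = 0" by (simp add: map_poly_to_ac_mult root)
    with eval_ac_cofactor_nonzero[OF odd_n alpha_pow_n that root] show False by simp
  qed
  have "red_poly (monom 1 n - 1) = h2 * k2" by (simp only: red_poly_monom_diff_1 k2)
  then obtain f :: "z4 poly" where f: "lead_coeff f = 1" "degree f = m" "red_poly f = h2"
    "f dvd monom 1 n - 1"
    using hensel_lift[OF irr deg _ ndvd[OF k2]] by blast
  show ?thesis
  proof (rule ex1I[of _ f])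
    show "lead_coeff f = 1 \<and> degree f = m \<and> red_poly f = h2 \<and> f dvd monom 1 n - 1"
      using f by blast
    fix f' :: "z4 poly"
    assume f': "lead_coeff f' = 1 \<and> degree f' = m \<and> red_poly f' = h2 \<and> f' dvd monom 1 n - 1"
    obtain k where k: "monom 1 n - 1 = f * k" using f(4) ..
    obtain k' where k': "monom 1 n - 1 = f' * k'" using f' by (auto elim: dvdE)
    have "red_poly (monom 1 n - 1) = red_poly f * red_poly k"
      by (simp only: k red_poly_mult)
    then have "monom 1 n - 1 = h2 * red_poly k"
      by (simp only: red_poly_monom_diff_1 f)
    then have "\<not> h2 dvd red_poly k" by (rule ndvd)
    moreover have "f * k = f' * k'" using k k' by simp
    ultimately have "f = f'"
      using f f' field_poly_irreducible_imp_prime[OF irr] hensel_unique by blast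
    then show "f' = f" ..
  qed
qed

context
  fixes h2 :: "bit poly" and h :: "z4 poly"
  assumes irr: "irreducible h2" and root: "eval_ac h2 \<alpha> = 0"
    and h: "lead_coeff h = 1" "degree h = m" "red_poly h = h2" "h dvd monom 1 n - 1"
begin

lemma poly_h_1_unit: "poly h 1 * poly h 1 = 1"
proof (rule red2_eq_1_imp_unit)
  have "degree h2 = m" using red_poly_monic(1)[OF h(1)] h by simp
  then have "poly h2 1 \<noteq> 0" using irreducible_poly_1_nonzero[OF irr] m2 by simp
  moreover have "red2 (poly p 1) = poly (red_poly p) 1" for p
    by (induction p) (simp_all add: map_poly_pCons)
  ultimately show "red2 (poly h 1) = 1" using h(3) by simp
qed

text \<open>Since the value of \<open>h\<close> at 1 is a unit, and not merely nonzero, the root 1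
  of \<open>X^n - 1\<close> passes to the cofactor of \<open>h\<close>.\<close>

lemma cofactor_exists: "\<exists>k. monom 1 n - 1 = ([:-1, 1:] * h) * k"
proof -
  obtain k where k: "monom 1 n - 1 = h * k" using h(4) ..
  have "poly h 1 * poly k 1 = poly (monom 1 n - 1) 1" by (simp only: k poly_mult)
  also have "\<dots> = 0" by (simp add: poly_monom)
  finally have "poly h 1 * poly h 1 * poly k 1 = 0" by (simp only: mult.assoc mult_zero_right)
  then have "[:-1, 1:] dvd k" using poly_h_1_unit by (simp add: poly_eq_0_iff_dvd)
  then obtain q where "k = [:-1, 1:] * q" ..
  then have "monom 1 n - 1 = ([:-1, 1:] * h) * q" by (simp only: k mult_ac)
  then show ?thesis ..
qed

abbreviation generator :: "z4 poly" where
  "generator \<equiv> reflect_poly (exact_quotient (monom 1 n - 1) ([:-1, 1:] * h))"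

lemma check_poly: "lead_coeff ([:-1, 1:] * h) = 1" "degree ([:-1, 1:] * h) = m + 1"
proof -
  have "h \<noteq> 0" using h(1) by auto
  then show "lead_coeff ([:-1, 1:] * h) = 1" "degree ([:-1, 1:] * h) = m + 1"
    using unit_lead_coeff_degree_mult[of "[:-1, 1:]" 1 h] h(1,2) by (simp_all del: mult_pCons_left)
qed

lemma generator_properties:
  shows "degree generator + (m + 1) = n"
    and "\<exists>u. lead_coeff generator * u = 1"
    and "generator dvd monom 1 n - 1"
    and "\<And>w. (\<And>t. w (t + n) = w t) \<Longrightarrow> (\<And>t. shift_act ([:-1, 1:] * h) w t = 0)
      \<Longrightarrow> generator dvd Poly (map w [0..<n])"
proof -
  obtain k where k: "monom 1 n - 1 = ([:-1, 1:] * h) * k" using cofactor_exists by blast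
  have "exact_quotient (monom 1 n - 1) ([:-1, 1:] * h) = k"
    using check_poly(1) k by (rule exact_quotient_eq)
  moreover note reflect_cofactor[OF odd_pos[OF odd_n] k check_poly(1) one_neq_zero] check_poly(2)
  ultimately show "degree generator + (m + 1) = n" "\<exists>u. lead_coeff generator * u = 1"
    "generator dvd monom 1 n - 1"
    "\<And>w. (\<And>t. w (t + n) = w t) \<Longrightarrow> (\<And>t. shift_act ([:-1, 1:] * h) w t = 0)
      \<Longrightarrow> generator dvd Poly (map w [0..<n])"
    by (simp_all only:)
qed

lemma linear_code_D: "linear_code (2 ^ m) (parity_extend ` cyclic_code n generator)"
  using linear_code_parity_extend[OF linear_code_cyclic_code[OF generator_properties(3)]]
  by (simp only: Suc_n Suc_eq_plus1[symmetric])

text \<open>Only the degree \<open>n - m - 1\<close> of the generator enters, so even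
  \<open>m\<close> is covered.\<close>

lemma card_D: "card (parity_extend ` cyclic_code n generator) = 4 ^ (m + 1)"
proof -
  obtain u where "lead_coeff generator * u = 1" using generator_properties(2) by blast
  from card_multiples_code[OF this generator_properties(1)]
  have "card (cyclic_code n generator) = 4 ^ (m + 1)"
    by (simp add: cyclic_code_eq[OF generator_properties(3)] del: mult_pCons_left)
  then show ?thesis by (simp only: card_image[OF inj_on_subset[OF inj_parity_extend subset_UNIV]])
qed

lemma word_in_D:
  assumes m: "odd m" and ab: "a \<in> GF2 m" "b \<in> GF2 m"
  shows "map (word m a b e) coords \<in> parity_extend ` cyclic_code n generator"
proof -
  let ?v = "\<lambda>t. word m a b 0 (\<alpha> ^ t)" and ?w = "\<lambda>t. word m a b e (\<alpha> ^ t)"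
  have split: "?w t = ?v t + e" for t by (simp add: word_def)
  have per: "?v (t + n) = ?v t" "?w (t + n) = ?w t" for t
    by (simp_all add: power_add alpha_pow_n)
  have prim: "\<exists>t. x = \<alpha> ^ t" if "x \<in> GF2 m" "x \<noteq> 0" for x
    using that range by (metis DiffI imageE singletonD)
  obtain k where k: "monom 1 n - 1 = h * k" using h(4) ..
  have "eval_ac (red_poly h) \<alpha> = 0" using root h(3) by simp
  then have zero: "shift_act h ?v t = 0" for t
    using shift_act_word_eq_0[OF m odd_n alpha_GF2 alpha_pow_n prim ab k] by blast
  have "shift_act ([:-1, 1:] * h) ?w t = 0" for t
  proof -
    \<comment> \<open>The factor \<open>X - 1\<close> removes the constant \<open>e\<close>; then
      the factors are exchanged, so that \<open>h\<close> meets the sequence it annihilates.\<close>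
    have "shift_act [:-1, 1:] ?w = shift_act [:-1, 1:] ?v"
      by (simp add: fun_eq_iff shift_act_pCons split)
    then have "shift_act ([:-1, 1:] * h) ?w t = shift_act [:-1, 1:] (shift_act h ?v) t"
      by (simp only: mult.commute[of "[:-1, 1:]" h] shift_act_mult)
        (simp only: mult.commute[of h "[:-1, 1:]"] flip: shift_act_mult)
    also have "\<dots> = 0" by (rule shift_act_zero_seq) (rule zero)
    finally show ?thesis .
  qed
  then have "generator dvd Poly (map ?w [0..<n])"
    using per(2) by (intro generator_properties(4))
  then have "map ?w [0..<n] \<in> cyclic_code n generator"
    by (simp add: cyclic_code_eq[OF generator_properties(3)] del: mult_pCons_left)
  moreover have "map (word m a b e) coords = parity_extend (map ?w [0..<n])"
  proof -
    \<comment> \<open>On the sum over a period \<open>h\<close> acts as its value at 1, a unit, so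
      the sum itself vanishes.\<close>
    have "poly h 1 * (\<Sum>t<n. ?v t) = 0"
      using sum_shift_act[of ?v n h, OF per(1)] by (simp add: zero)
    then have "poly h 1 * poly h 1 * (\<Sum>t<n. ?v t) = 0" by (simp only: mult.assoc mult_zero_right)
    then have "(\<Sum>t<n. ?v t) = 0" by (simp only: poly_h_1_unit mult_1_left)
    moreover have "sum_list (map ?w [0..<n]) = (\<Sum>t<n. ?v t) + of_nat n * e"
      unfolding interv_sum_list_conv_sum_set_nat split by (simp add: sum.distrib atLeast0LessThan)
    \<comment> \<open>As \<open>n\<close> is -1 modulo 4, the constant contributes
      \<open>- e\<close> to the sum; the check symbol is therefore \<open>e\<close>, the value of
      the word at the field element 0.\<close>
    ultimately have "- sum_list (map ?w [0..<n]) = e"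
      unfolding n_def of_nat_pow2_minus_1[OF m2] by simp
    then show ?thesis by (simp add: coords_def parity_extend_def word_def o_def)
  qed
  ultimately show ?thesis by blast
qed

lemma D_eq_quaternary_kerdock:
  assumes "odd m"
  shows "parity_extend ` cyclic_code n generator = quaternary_kerdock m coords"
proof (rule card_subset_eq[symmetric])
  show "finite (parity_extend ` cyclic_code n generator)"
    by (rule card_ge_0_finite) (simp only: card_D, simp)
  show "quaternary_kerdock m coords \<subseteq> parity_extend ` cyclic_code n generator"
    unfolding quaternary_kerdock_def using word_in_D[OF assms] by auto
  show "card (quaternary_kerdock m coords) = card (parity_extend ` cyclic_code n generator)"
    using card_quaternary_kerdock[OF assms distinct_coords set_coords] card_D by simp
qed

end

end

theorem theorem5:
  fixes m n :: nat
    and h2 :: "bit poly"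
    and h g :: "z4 poly"
    and D :: "z4 list set"
    and K :: "bit list set"
  assumes "m \<ge> 2"
    and "n = 2 ^ m - 1"
    and "irreducible h2"
    and "degree h2 = m"
    and "primitive_poly m h2"
    and "h = (THE f. lead_coeff f = 1 \<and> degree f = m \<and> map_poly red2 f = h2 \<and> f dvd monom 1 n - 1)"
    and "g = reflect_poly (exact_quotient (monom 1 n - 1) ([:-1, 1:] * h))"
    and "D = parity_extend ` cyclic_code n g"
    and "K = \<phi> ` D"
  shows "(\<exists>!f :: z4 poly.
            lead_coeff f = 1 \<and> degree f = m \<and> map_poly red2 f = h2 \<and> f dvd monom 1 n - 1) \<and>
         linear_code (2 ^ m) D \<and> card D = 4 ^ (m + 1) \<and>
         (odd m \<and> m \<ge> 3 \<longrightarrow>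
            card K = 2 ^ (2 * m + 2) \<and>
            minimal_distance K = 2 ^ m - 2 ^ ((m - 1) div 2) \<and>
            (\<forall>xs. distinct xs \<and> set xs = GF2 m \<longrightarrow>
               equal_up_to_permutation (2 ^ (m + 1)) K (kerdock_code m xs) \<and>
               card (kerdock_code m xs) = 2 ^ (2 * m + 2) \<and>
               minimal_distance (kerdock_code m xs) = 2 ^ m - 2 ^ ((m - 1) div 2)))"
proof -
  obtain \<alpha> where root: "eval_ac h2 \<alpha> = 0" and range: "range (\<lambda>k::nat. \<alpha> ^ k) = GF2 m - {0}"
    using assms(5) unfolding primitive_poly_def by blast
  interpret primitive_root m n \<alpha>
    by unfold_locales (fact assms(1), fact assms(2), fact range)
  have ex1: "\<exists>!f :: z4 poly.
      lead_coeff f = 1 \<and> degree f = m \<and> red_poly f = h2 \<and> f dvd monom 1 n - 1"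
    using assms(3,4) root by (rule lift_exists_unique)
  have h: "lead_coeff h = 1" "degree h = m" "red_poly h = h2" "h dvd monom 1 n - 1"
    using theI'[OF ex1] unfolding assms(6)[symmetric] by blast+
  note D = linear_code_D[OF assms(3) root h] card_D[OF assms(3) root h]
  have odd: "card K = 2 ^ (2 * m + 2) \<and>
      minimal_distance K = 2 ^ m - 2 ^ ((m - 1) div 2) \<and>
      (\<forall>xs. distinct xs \<and> set xs = GF2 m \<longrightarrow>
         equal_up_to_permutation (2 ^ (m + 1)) K (kerdock_code m xs) \<and>
         card (kerdock_code m xs) = 2 ^ (2 * m + 2) \<and>
         minimal_distance (kerdock_code m xs) = 2 ^ m - 2 ^ ((m - 1) div 2))" if m: "odd m"
  proof -
    have K: "K = \<phi> ` quaternary_kerdock m coords"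
      unfolding assms(9,8,7) D_eq_quaternary_kerdock[OF assms(3) root h m] ..
    \<comment> \<open>The code arises in the order \<open>coords\<close>; any other enumeration
      \<open>xs\<close> differs by a permutation, while size and distance for \<open>xs\<close> come
      from \<open>kerdock_code_eq\<close>.\<close>
    show ?thesis unfolding K
      using card_phi_quaternary_kerdock[OF m] minimal_distance_phi_quaternary_kerdock[OF m]
        quaternary_kerdock_permutation[OF distinct_coords set_coords] kerdock_code_eq
        distinct_coords set_coords odd_pos[OF m]
      by simp
  qed
  show ?thesis using ex1 D odd unfolding assms(8,7) by blast
qed

end
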